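(* Let $\emptyset\neq G\subset\mathbb{R}^n$ be an open set, $0<\varepsilon,s<1$ and $1<p<\infty$. Fix a measurable function $R:G\to\mathbb{R}$ satisfying $0\le R(x)\le \operatorname{dist}(x,\partial G)$ for every $x\in G$. Then there exists a constant $C=C(n,p,\varepsilon)>0$, depending only on $n$, $p$ and $\varepsilon$, such that the inequality $$\int_G\int_G \frac{|M_R(f)(x)-M_R(f)(y)|^p}{(|x-y|+|R(x)-R(y)|)^{\varepsilon+sp}}\,\frac{dy\,dx}{|x-y|^{n-\varepsilon}}\le C\int_G\int_G\frac{|f(x)-f(y)|^p}{|x-y|^{n+sp}}\,dy\,dx$$ holds for every $f\in L^p(G)$.
   Context: Convention: $\operatorname{dist}(x,\partial G)=\infty$ if $x\in G=\mathbb{R}^n$. $B(x,r)$ is the open ball of center $x$ and radius $r$. For a measurable $R:G\to\mathbb{R}$ with $0\le R(x)\le\operatorname{dist}(x,\partial G)$ on $G$, and $f\in L^1_{\mathrm{loc}}(G)$, the maximal-type operator $M_R$ is defined for every $x\in G$ by $$M_R(f)(x)=\sup_{0\le r\le R(x)}\frac{1}{|B(x,r)|}\int_{B(x,r)}|f(y)|\,dy,$$ where for $r=0$ the average is by convention equal to $|f(x)|$. *)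

theory Defs
  imports "HOL-Analysis.Analysis"
begin

(* infdist to the empty set is 0 in the library, hence the case distinction. *)
definition boundary_dist :: "(real ^ 'n) set \<Rightarrow> real ^ 'n \<Rightarrow> ereal" where
  "boundary_dist G x = (if G = UNIV then \<infinity> else ereal (infdist x (frontier G)))"

definition in_Lp :: "real \<Rightarrow> (real ^ 'n) set \<Rightarrow> (real ^ 'n \<Rightarrow> real) \<Rightarrow> bool" where
  "in_Lp p G f \<longleftrightarrow> f \<in> borel_measurable (lebesgue_on G)
     \<and> integrable (lebesgue_on G) (\<lambda>x. \<bar>f x\<bar> powr p)"

definition ball_average :: "(real ^ 'n \<Rightarrow> real) \<Rightarrow> real ^ 'n \<Rightarrow> real \<Rightarrow> ennreal" where
  "ball_average f x r =
     (if r = 0 then ennreal \<bar>f x\<bar>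
      else (\<integral>\<^sup>+ y. ennreal \<bar>f y\<bar> \<partial>lebesgue_on (ball x r)) / emeasure lebesgue (ball x r))"

(* Extended-valued, since the supremum can be infinite at exceptional points.
   When R x is at most boundary_dist G x, the open balls involved lie in G, so
   only the values of f on G matter. *)
definition max_op :: "(real ^ 'n \<Rightarrow> real) \<Rightarrow> (real ^ 'n \<Rightarrow> real) \<Rightarrow> real ^ 'n \<Rightarrow> ennreal" where
  "max_op R f x = (SUP r \<in> {0..R x}. ball_average f x r)"

(* |a - b|, with value \<infinity> as soon as one of a, b is infinite. *)
definition absdiff :: "ennreal \<Rightarrow> ennreal \<Rightarrow> ennreal" where
  "absdiff a b = e2ennreal \<bar>enn2ereal a - enn2ereal b\<bar>"

(* Real powers of extended nonnegative numbers, for positive exponents. *)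
definition ennpowr :: "ennreal \<Rightarrow> real \<Rightarrow> ennreal" where
  "ennpowr a p = (if a = \<infinity> then \<infinity> else ennreal (enn2real a powr p))"

end

theory Submission
  imports Defs
begin

text \<open>Compare a ball average at \<open>x\<close> of radius \<open>r \<le> R x\<close> with the one at \<open>y\<close> of radius
  \<open>q = min r (R y)\<close>. If \<open>r \<le> 2|x - y|\<close>, all points \<open>u \<in> B(x,r)\<close>, \<open>v \<in> B(y,q)\<close> satisfy
  \<open>|u - v| \<le> 5|x - y|\<close>, so the difference is controlled by the strong maximal function of
  \<open>|f(u) - f(v)| / |u - v| powr (n/p + s)\<close> on \<open>G \<times> G\<close>, which is bounded on \<open>L\<^sup>p\<close>. Otherwise set
  \<open>t = max (r - q) |x - y| \<le> r\<close>: the points \<open>x + rz\<close> and \<open>y + qz\<close> are at distance at most \<open>2t\<close>, and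
  there is a ball of radius \<open>t/2\<close> inside \<open>B(x,r)\<close> close to both of them. Averaging over that ball bounds
  the difference by Hardy--Littlewood maximal functions of the mean oscillation of \<open>f\<close> at scale
  \<open>2^k\<close> with \<open>t \<le> 2^k < 2t\<close>, evaluated at \<open>x\<close> and at \<open>y\<close>. Since \<open>t\<close> is at most
  \<open>|x - y| + |R x - R y|\<close>, one may sum over all \<open>k\<close> with \<open>|x - y| \<le> 2^k\<close>; the singular factor
  \<open>|x - y| powr (\<epsilon> - n)\<close> integrates over this region to a multiple of \<open>2^(k\<epsilon>)\<close>, and the sum over \<open>k\<close> is
  geometric, with a bound uniform in \<open>s\<close>.\<close>

subsection \<open>Powers and dyadic sums\<close>

text \<open>The constant may not depend on \<open>s\<close>, so the powers of \<open>2^k\<close>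
  must be spent carefully. The weight contributes \<open>2^(-k (\<epsilon> + s p))\<close>. Its part
  \<open>2^(-k \<epsilon>)\<close> is used up by the mass of the truncated singular factor; that
  mass is a geometric series of ratio \<open>2 powr - \<epsilon>\<close>, and so the constant
  depends on \<epsilon>. The remaining \<open>2^(-k s p)\<close>, summed alone, would blow up as
  \<open>s\<close> tends to \<open>0\<close>. But by Jensen's inequality the p-th power of a mean
  oscillation is at most a mean of p-th powers, whose normalisation by volume brings a further
  \<open>2^(-k n)\<close>. For a fixed pair \<open>(u, w)\<close> the sum over
  \<open>2^k \<ge> |u - w| / 3\<close> has exponent \<open>n + s p \<ge> 1\<close>, and it
  reproduces \<open>|u - w| powr - (n + s p)\<close> up to a factor that is bounded because
  \<open>s < 1\<close>.

  For this reason all oscillations are cut off to \<open>G\<close>, and each intermediate point is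
  taken inside a ball already known to lie in \<open>G\<close>.\<close>

lemma ennpowr_ennreal: "0 \<le> a \<Longrightarrow> ennpowr (ennreal a) p = ennreal (a powr p)"
  by (simp add: ennpowr_def)

lemma ennpowr_top [simp]: "ennpowr top p = top"
  by (simp add: ennpowr_def)

lemma ennpowr_0 [simp]: "ennpowr 0 p = 0"
  by (simp add: ennpowr_def)

lemma ennpowr_1 [simp]: "ennpowr a 1 = a"
  by (cases a) (auto simp: ennpowr_def)

lemma ennpowr_mono: "0 \<le> p \<Longrightarrow> a \<le> b \<Longrightarrow> ennpowr a p \<le> ennpowr b p"
  by (cases a; cases b) (auto simp: ennpowr_ennreal top_unique intro!: powr_mono2)

lemma ennpowr_mult:
  assumes "0 < p" shows "ennpowr (a * b) p = ennpowr a p * ennpowr b p"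
proof (cases "a = 0 \<or> b = 0")
  case False
  then show ?thesis
    by (cases a; cases b)
      (auto simp: ennpowr_ennreal powr_mult ennreal_mult[symmetric] ennreal_mult_top ennreal_top_mult)
qed auto

lemma ennpowr_ennpowr: "0 < p \<Longrightarrow> 0 < q \<Longrightarrow> ennpowr (ennpowr a p) q = ennpowr a (p * q)"
  by (cases a) (auto simp: ennpowr_ennreal powr_powr)

lemma ennpowr_max: "0 \<le> p \<Longrightarrow> ennpowr (max a b) p = max (ennpowr a p) (ennpowr b p)"
  using ennpowr_mono[of p a b] ennpowr_mono[of p b a] by (auto simp: max_def)

lemma ennpowr_max_le: "0 \<le> p \<Longrightarrow> ennpowr (max a b) p \<le> ennpowr a p + ennpowr b p"
  by (auto simp: ennpowr_max)

lemma ennpowr_add_le: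
  assumes "0 < p"
  shows "ennpowr (a + b) p \<le> ennreal (2 powr p) * (ennpowr a p + ennpowr b p)"
proof -
  have "a + b \<le> 2 * max a b"
    by (simp add: add_mono mult_2)
  then have "ennpowr (a + b) p \<le> ennpowr (2 * max a b) p"
    using assms by (intro ennpowr_mono) auto
  also have "\<dots> = ennreal (2 powr p) * ennpowr (max a b) p"
    using assms ennpowr_ennreal[of 2 p] by (simp add: ennpowr_mult)
  also have "\<dots> \<le> ennreal (2 powr p) * (ennpowr a p + ennpowr b p)"
    using assms by (intro mult_left_mono ennpowr_max_le) auto
  finally show ?thesis .
qed

lemma ennpowr_measurable [measurable]:
  assumes [measurable]: "f \<in> borel_measurable M"
  shows "(\<lambda>x. ennpowr (f x) p) \<in> borel_measurable M"
  unfolding ennpowr_def by measurable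

text \<open>Young's inequality with the mean \<open>m\<close> gives
  \<open>p m^(p-1) t \<le> t^p + (p-1) m^p\<close>, the tangent line bound at \<open>m\<close>;
  integrated over a probability measure, the finite term \<open>(p-1) m^p\<close> cancels. If the
  mean is infinite, \<open>t \<le> 1 + t^p\<close> shows that the right side is infinite
  too.\<close>

lemma jensen_ennpowr:
  fixes g :: "'a \<Rightarrow> ennreal"
  assumes [measurable]: "g \<in> borel_measurable M" and M: "emeasure M (space M) = 1" and p: "1 < p"
  shows "ennpowr (\<integral>\<^sup>+x. g x \<partial>M) p \<le> (\<integral>\<^sup>+x. ennpowr (g x) p \<partial>M)"
proof (cases "\<integral>\<^sup>+x. g x \<partial>M")
  case (real m)
  have young: "ennreal (p * m powr (p - 1)) * g x \<le> ennpowr (g x) p + ennreal ((p - 1) * m powr p)" for x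
  proof (cases "g x")
    case (real t)
    have "p * m powr (p - 1) * t \<le> t powr p + (p - 1) * m powr p"
    proof -
      have "t * m powr (p - 1) \<le> t powr p / p + (m powr (p - 1)) powr (p / (p - 1)) / (p / (p - 1))"
        using real p by (intro Youngs_inequality) (auto simp: field_simps)
      also have "(m powr (p - 1)) powr (p / (p - 1)) = m powr p"
        using p by (simp add: powr_powr)
      finally show ?thesis
        using p by (simp add: field_simps)
    qed
    then show ?thesis
      using real p by (simp add: ennpowr_ennreal ennreal_mult[symmetric] ennreal_plus[symmetric] del: ennreal_plus)
  qed simp
  have "ennreal (p * m powr (p - 1)) * ennreal m \<le> (\<integral>\<^sup>+x. ennpowr (g x) p + ennreal ((p - 1) * m powr p) \<partial>M)"
    unfolding real(2)[symmetric]
    by (subst nn_integral_cmult[symmetric]) (auto intro!: nn_integral_mono young)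
  also have "\<dots> = (\<integral>\<^sup>+x. ennpowr (g x) p \<partial>M) + ennreal ((p - 1) * m powr p)"
    using M by (subst nn_integral_add) auto
  finally have *: "ennreal (p * m powr (p - 1)) * ennreal m
      \<le> (\<integral>\<^sup>+x. ennpowr (g x) p \<partial>M) + ennreal ((p - 1) * m powr p)" .
  have "p * m powr (p - 1) * m = m powr p + (p - 1) * m powr p"
    using \<open>0 \<le> m\<close> p by (cases "m = 0") (auto simp: powr_diff field_simps)
  then have "ennreal (m powr p) + ennreal ((p - 1) * m powr p)
     \<le> (\<integral>\<^sup>+x. ennpowr (g x) p \<partial>M) + ennreal ((p - 1) * m powr p)"
    using * p \<open>0 \<le> m\<close> by (simp add: ennreal_mult[symmetric] ennreal_plus[symmetric] del: ennreal_plus)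
  then show ?thesis
    using real by (simp add: ennpowr_ennreal)
next
  case top
  have "g x \<le> 1 + ennpowr (g x) p" for x
  proof (cases "g x")
    case (real t)
    have "t \<le> 1 + t powr p"
      using powr_mono[of 1 p t] p real by (cases "t \<le> 1") (auto simp: add_increasing2 powr_ge_zero)
    then have "ennreal t \<le> ennreal (1 + t powr p)" by (rule ennreal_leI)
    then show ?thesis using real by (simp add: ennpowr_ennreal)
  qed simp
  then have "(\<integral>\<^sup>+x. g x \<partial>M) \<le> (\<integral>\<^sup>+x. 1 + ennpowr (g x) p \<partial>M)"
    by (intro nn_integral_mono)
  also have "\<dots> = 1 + (\<integral>\<^sup>+x. ennpowr (g x) p \<partial>M)"
    using M by (subst nn_integral_add) auto
  finally show ?thesis using top by (simp add: top_unique)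
qed

text \<open>The admissible \<open>k\<close> form a half line starting at \<open>k0\<close>, so this
  is a geometric series of ratio \<open>2 powr - q\<close> with first term at most
  \<open>a powr - q\<close>. Sums over the integers are written as integrals over
  \<open>count_space\<close> so that they can be interchanged with Lebesgue integrals.\<close>

lemma dyadic_sum_ge:
  fixes a q :: real
  assumes "0 < a" "0 < q"
  shows "(\<integral>\<^sup>+k. ennreal (2 powr (- real_of_int k * q)) * indicator {k. a \<le> 2 powr real_of_int k} k
           \<partial>count_space UNIV) \<le> ennreal (a powr - q / (1 - 2 powr - q))"
proof -
  define k0 where "k0 = \<lceil>log 2 a\<rceil>"
  have set_eq: "{k::int. a \<le> 2 powr real_of_int k} = (\<lambda>i. k0 + int i) ` UNIV"
  proof -
    have "a \<le> 2 powr real_of_int k \<longleftrightarrow> k0 \<le> k" for k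
      using assms by (simp add: k0_def ceiling_le_iff log_le_iff)
    moreover have "k0 \<le> k \<longleftrightarrow> (\<exists>i. k = k0 + int i)" for k
      using zle_iff_zadd by auto
    ultimately show ?thesis by auto
  qed
  have q1: "2 powr - q < 1" using assms by (simp add: powr_less_one)
  have "(\<integral>\<^sup>+k. ennreal (2 powr (- real_of_int k * q)) * indicator {k. a \<le> 2 powr real_of_int k} k \<partial>count_space UNIV)
      = (\<integral>\<^sup>+k. ennreal (2 powr (- real_of_int k * q)) \<partial>count_space ((\<lambda>i. k0 + int i) ` UNIV))"
    by (simp add: set_eq nn_integral_count_space_indicator)
  also have "\<dots> = (\<integral>\<^sup>+i. ennreal (2 powr (- real_of_int (k0 + int i) * q)) \<partial>count_space UNIV)"
    by (rule nn_integral_bij_count_space[symmetric]) (auto simp: bij_betw_def inj_on_def)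
  also have "\<dots> = (\<Sum>i. ennreal (2 powr (- real_of_int k0 * q) * (2 powr - q) ^ i))"
    by (simp add: nn_integral_count_space_nat powr_realpow[symmetric] powr_powr powr_add[symmetric] algebra_simps)
  also have "\<dots> = ennreal (2 powr (- real_of_int k0 * q) * (1 / (1 - 2 powr - q)))"
    using q1 by (intro suminf_ennreal_eq sums_mult geometric_sums) auto
  also have "\<dots> \<le> ennreal (a powr - q / (1 - 2 powr - q))"
  proof -
    have "log 2 a \<le> k0" by (simp add: k0_def)
    then have "2 powr (- real_of_int k0 * q) \<le> 2 powr (log 2 a * - q)"
      using assms by (intro powr_mono) auto
    also have "\<dots> = (2 powr log 2 a) powr - q"
      by (simp only: powr_powr)
    also have "\<dots> = a powr - q"
      using assms by simp
    finally show ?thesis using q1 by (intro ennreal_leI) (simp add: divide_right_mono)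
  qed
  finally show ?thesis .
qed

lemma dyadic_sum_le:
  fixes b q :: real
  assumes "0 < b" "0 < q"
  shows "(\<integral>\<^sup>+k. ennreal (2 powr (real_of_int k * q)) * indicator {k. 2 powr real_of_int k \<le> b} k
           \<partial>count_space UNIV) \<le> ennreal (b powr q / (1 - 2 powr - q))"
proof -
  have *: "2 powr - real_of_int k \<le> b \<longleftrightarrow> 1 / b \<le> 2 powr real_of_int k" for k
    using assms by (simp add: powr_minus field_simps)
  have "(\<integral>\<^sup>+k. ennreal (2 powr (real_of_int k * q)) * indicator {k. 2 powr real_of_int k \<le> b} k \<partial>count_space UNIV)
      = (\<integral>\<^sup>+k. ennreal (2 powr (real_of_int (- k) * q)) * indicator {k. 2 powr real_of_int k \<le> b} (- k) \<partial>count_space UNIV)"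
    by (rule nn_integral_bij_count_space[symmetric]) (rule bij_uminus)
  also have "\<dots> = (\<integral>\<^sup>+k. ennreal (2 powr (- real_of_int k * q)) * indicator {k. 1 / b \<le> 2 powr real_of_int k} k \<partial>count_space UNIV)"
    by (intro nn_integral_cong) (auto simp: indicator_def *)
  also have "\<dots> \<le> ennreal ((1 / b) powr - q / (1 - 2 powr - q))"
    using assms by (intro dyadic_sum_ge) auto
  finally show ?thesis using assms by (simp add: powr_divide powr_minus_divide)
qed

lemma ex_dyadic_ge:
  fixes t :: real
  assumes "0 < t"
  obtains k :: int where "t \<le> 2 powr real_of_int k" "2 powr real_of_int k < 2 * t"
proof
  show "t \<le> 2 powr real_of_int \<lceil>log 2 t\<rceil>"
    using assms by (simp add: log_le_iff[symmetric])
  have "real_of_int \<lceil>log 2 t\<rceil> < log 2 t + 1" by linarith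
  then have "2 powr real_of_int \<lceil>log 2 t\<rceil> < 2 powr (log 2 t + 1)" by simp
  then show "2 powr real_of_int \<lceil>log 2 t\<rceil> < 2 * t"
    using assms by (simp add: powr_add)
qed

lemma nn_integral_count_space_ge:
  fixes h :: "'i \<Rightarrow> ennreal"
  shows "h k \<le> (\<integral>\<^sup>+k. h k \<partial>count_space UNIV)"
  by (rule nn_integral_ge_point) auto

subsection \<open>Averages over balls\<close>

lemma emeasure_ball_pos: "0 < r \<Longrightarrow> emeasure lborel (ball (x::'a::euclidean_space) r) \<noteq> 0"
  using content_ball_gt_0_iff[of x r] by (auto simp: measure_def)

lemma emeasure_ball_finite: "emeasure lborel (ball (x::'a::euclidean_space) r) \<noteq> \<infinity>"
  using emeasure_lborel_ball_finite[of x r] by auto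

lemma ennreal_inverse_mono: "a \<le> b \<Longrightarrow> inverse b \<le> inverse (a::ennreal)"
proof (cases a; cases b)
  fix r q assume "a \<le> b" "a = ennreal r" "b = ennreal q" "0 \<le> r" "0 \<le> q"
  then show "inverse b \<le> inverse a"
    by (cases "r = 0") (auto simp: inverse_ennreal intro!: ennreal_leI le_imp_inverse_le)
qed (auto simp: top_unique)

lemma emeasure_UN_countable_le:
  assumes I: "countable I" and X [measurable]: "\<And>i. i \<in> I \<Longrightarrow> X i \<in> sets M"
  shows "emeasure M (\<Union>i\<in>I. X i) \<le> (\<integral>\<^sup>+i. emeasure M (X i) \<partial>count_space I)"
proof -
  have "emeasure M (\<Union>i\<in>I. X i) = (\<integral>\<^sup>+x. indicator (\<Union>i\<in>I. X i) x \<partial>M)"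
    using I by (intro nn_integral_indicator[symmetric] sets.countable_UN') auto
  also have "\<dots> \<le> (\<integral>\<^sup>+x. (\<integral>\<^sup>+i. indicator (X i) x \<partial>count_space I) \<partial>M)"
  proof (intro nn_integral_mono)
    fix x
    show "indicator (\<Union>i\<in>I. X i) x \<le> (\<integral>\<^sup>+i. indicator (X i) x \<partial>count_space I)"
    proof (cases "x \<in> (\<Union>i\<in>I. X i)")
      case True
      then obtain i where i: "i \<in> I" "x \<in> X i" by auto
      then show ?thesis
        using nn_integral_ge_point[of i I "\<lambda>i. indicator (X i) x"] True by simp
    qed simp
  qed
  also have "\<dots> = (\<integral>\<^sup>+i. (\<integral>\<^sup>+x. indicator (X i) x \<partial>M) \<partial>count_space I)"
    using I by (intro nn_integral_count_space_nn_integral) auto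
  also have "\<dots> = (\<integral>\<^sup>+i. emeasure M (X i) \<partial>count_space I)"
    by (intro nn_integral_cong) (auto intro!: nn_integral_indicator)
  finally show ?thesis .
qed

lemma emeasure_ball_scale:
  fixes x :: "'a::euclidean_space"
  assumes "0 \<le> r"
  shows "emeasure lborel (ball x r) = ennreal (r ^ DIM('a)) * emeasure lborel (ball (0::'a) 1)"
proof -
  have "emeasure lborel (ball x r) = ennreal (measure lborel (ball x r))"
    using emeasure_ball_finite by (intro emeasure_eq_ennreal_measure) auto
  also have "\<dots> = ennreal (r ^ DIM('a)) * ennreal (measure lborel (ball (0::'a) 1))"
    using content_ball_conv_unit_ball[OF assms, of x] assms by (simp add: ennreal_mult)
  also have "ennreal (measure lborel (ball (0::'a) 1)) = emeasure lborel (ball (0::'a) 1)"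
    using emeasure_ball_finite by (intro emeasure_eq_ennreal_measure[symmetric]) auto
  finally show ?thesis .
qed

lemma nn_integral_affine:
  fixes h :: "'a::euclidean_space \<Rightarrow> ennreal"
  assumes [measurable]: "h \<in> borel_measurable borel" and "0 < r"
  shows "(\<integral>\<^sup>+y. h y \<partial>lborel) = ennreal (r ^ DIM('a)) * (\<integral>\<^sup>+z. h (x + r *\<^sub>R z) \<partial>lborel)"
  using \<open>0 < r\<close>
  by (subst lborel_affine[of r x]) (auto simp: nn_integral_density nn_integral_distr nn_integral_cmult)

definition unif_ball :: "'a::euclidean_space measure" where
  "unif_ball = uniform_measure lborel (ball 0 1)"

lemma sets_unif_ball [measurable_cong, simp]: "sets unif_ball = sets borel"
  by (simp add: unif_ball_def)

lemma space_unif_ball [simp]: "space unif_ball = UNIV"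
  by (simp add: unif_ball_def)

lemma prob_space_unif_ball: "emeasure unif_ball (space (unif_ball :: 'a::euclidean_space measure)) = 1"
  unfolding unif_ball_def
  using emeasure_ball_pos[of 1 "0::'a"] emeasure_ball_finite[of "0::'a" 1]
  by (simp add: emeasure_uniform_measure less_top)

interpretation unif_ball: finite_measure unif_ball
  by standard (simp add: prob_space_unif_ball[simplified])

lemma AE_unif_ball: "AE z in unif_ball. norm z < 1"
  unfolding unif_ball_def by (rule AE_uniform_measureI) auto

lemma nn_integral_unif_ball:
  fixes g :: "'a::euclidean_space \<Rightarrow> ennreal"
  assumes "g \<in> borel_measurable borel"
  shows "(\<integral>\<^sup>+z. g z \<partial>unif_ball) = (\<integral>\<^sup>+z. g z * indicator (ball 0 1) z \<partial>lborel) / emeasure lborel (ball (0::'a) 1)"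
  unfolding unif_ball_def using assms by (simp add: nn_integral_uniform_measure)

text \<open>A mean over a uniform point \<open>z\<close> of the unit ball instead of a quotient of
  integrals. Radius 0 then yields \<open>g x\<close>, which agrees with the convention for
  \<open>ball_average\<close>; joint measurability in centre and radius is immediate; and averages
  over two different balls can be compared through the same \<open>z\<close>.\<close>

definition avg :: "('a::euclidean_space \<Rightarrow> ennreal) \<Rightarrow> 'a \<Rightarrow> real \<Rightarrow> ennreal" where
  "avg g x r = (\<integral>\<^sup>+z. g (x + r *\<^sub>R z) \<partial>unif_ball)"

lemma avg_0 [simp]: "avg g (x::'a::euclidean_space) 0 = g x"
  using prob_space_unif_ball[where 'a='a] by (simp add: avg_def)

lemma avg_measurable [measurable]:
  assumes [measurable]: "(\<lambda>(x, y). g x y) \<in> borel_measurable (M \<Otimes>\<^sub>M borel)" "h \<in> borel_measurable M" "r \<in> borel_measurable M"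
  shows "(\<lambda>x. avg (g x) (h x) (r x)) \<in> borel_measurable M"
  unfolding avg_def by measurable

lemma avg_eq:
  fixes g :: "'a::euclidean_space \<Rightarrow> ennreal"
  assumes [measurable]: "g \<in> borel_measurable borel" and r: "0 < r"
  shows "avg g x r = (\<integral>\<^sup>+y. g y * indicator (ball x r) y \<partial>lborel) / emeasure lborel (ball x r)"
proof -
  have r': "ennreal (r ^ DIM('a)) \<noteq> 0" "ennreal (r ^ DIM('a)) \<noteq> \<infinity>" using r by auto
  have "(\<integral>\<^sup>+y. g y * indicator (ball x r) y \<partial>lborel)
      = ennreal (r ^ DIM('a)) * (\<integral>\<^sup>+z. g (x + r *\<^sub>R z) * indicator (ball x r) (x + r *\<^sub>R z) \<partial>lborel)"
    using r by (intro nn_integral_affine borel_measurable_times_ennreal borel_measurable_indicator) auto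
  also have "(\<lambda>z. indicator (ball x r) (x + r *\<^sub>R z) :: ennreal) = indicator (ball 0 1)"
    using r by (auto simp: indicator_def dist_norm fun_eq_iff)
  finally have "(\<integral>\<^sup>+y. g y * indicator (ball x r) y \<partial>lborel) / emeasure lborel (ball x r)
      = (\<integral>\<^sup>+z. g (x + r *\<^sub>R z) * indicator (ball 0 1) z \<partial>lborel) * ennreal (r ^ DIM('a)) /
        (emeasure lborel (ball (0::'a) 1) * ennreal (r ^ DIM('a)))"
    using r by (simp add: emeasure_ball_scale[of r x] mult.commute)
  then show ?thesis
    unfolding avg_def divide_mult_eq[OF r'] by (simp add: nn_integral_unif_ball)
qed

text \<open>Enlarging the domain only raises the integral, and the price is the ratio of the
  volumes, at most \<open>K ^ DIM('a)\<close>. The centres may differ, as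
  \<open>avg_diff_near\<close> requires.\<close>

lemma avg_le_superball:
  fixes g :: "'a::euclidean_space \<Rightarrow> ennreal"
  assumes [measurable]: "g \<in> borel_measurable borel" and r: "0 < r" "ball x r \<subseteq> ball u q" "q \<le> K * r"
  shows "avg g x r \<le> ennreal (K ^ DIM('a)) * avg g u q"
proof -
  let ?I = "\<lambda>x r. \<integral>\<^sup>+y. g y * indicator (ball x r) y \<partial>lborel"
  let ?K = "ennreal (K ^ DIM('a))"
  have "x \<in> ball u q" using r centre_in_ball by blast
  then have q: "0 < q" by (metis empty_iff ball_eq_empty not_le)
  with r have K: "0 < K" by (metis less_le_trans zero_less_mult_pos2)
  have "emeasure lborel (ball u q) \<le> emeasure lborel (ball x (K * r))"
    using q K r power_mono[of q "K * r" "DIM('a)"]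
    by (simp add: emeasure_ball_scale[of q u] emeasure_ball_scale[of "K * r" x] mult_right_mono ennreal_leI)
  also have "\<dots> = ?K * emeasure lborel (ball x r)"
    using r K by (simp add: emeasure_ball_scale[of "K * r" x] emeasure_ball_scale[of r x] power_mult_distrib ennreal_mult mult.assoc)
  finally have vol: "emeasure lborel (ball u q) \<le> ?K * emeasure lborel (ball x r)" .
  have "avg g x r = ?I x r / emeasure lborel (ball x r)"
    using r by (intro avg_eq) auto
  also have "\<dots> \<le> ?I u q / emeasure lborel (ball x r)"
    using r by (intro divide_right_mono_ennreal nn_integral_mono) (auto simp: indicator_def)
  also have "\<dots> = ?K * (?I u q / (?K * emeasure lborel (ball x r)))"
    using divide_mult_eq[of ?K "?I u q" "emeasure lborel (ball x r)"] K by (simp add: mult.commute ennreal_times_divide)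
  also have "\<dots> \<le> ?K * (?I u q / emeasure lborel (ball u q))"
    using vol by (intro mult_left_mono) (auto simp: divide_ennreal_def intro!: mult_left_mono ennreal_inverse_mono)
  also have "\<dots> = ?K * avg g u q"
    using q by (subst avg_eq) auto
  finally show ?thesis .
qed

lemma avg_mono: "(\<And>z. g z \<le> h z) \<Longrightarrow> avg g x r \<le> avg h x r"
  unfolding avg_def by (intro nn_integral_mono) auto

lemma avg_add:
  assumes [measurable]: "g \<in> borel_measurable borel" "h \<in> borel_measurable borel"
  shows "avg (\<lambda>z. g z + h z) x r = avg g x r + avg h x r"
  unfolding avg_def by (intro nn_integral_add) auto

lemma avg_cmult:
  assumes [measurable]: "g \<in> borel_measurable borel"
  shows "avg (\<lambda>z. c * g z) x r = c * avg g x r"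
  unfolding avg_def by (intro nn_integral_cmult) auto

subsection \<open>The Hardy--Littlewood maximal theorem\<close>

text \<open>Radii \<open>2^k\<close> keep the supremum countable, hence measurable, and lose only a
  factor \<open>2 ^ DIM('a)\<close> against arbitrary radii (\<open>avg_le_hlmax\<close>).\<close>

definition dmax :: "('a::euclidean_space \<Rightarrow> ennreal) \<Rightarrow> 'a \<Rightarrow> ennreal" where
  "dmax g x = (SUP k::int. avg g x (2 powr real_of_int k))"

text \<open>The value \<open>g x\<close> is included to cover radius 0 at every point, not only at
  Lebesgue points.\<close>

definition hlmax :: "('a::euclidean_space \<Rightarrow> ennreal) \<Rightarrow> 'a \<Rightarrow> ennreal" where
  "hlmax g x = max (g x) (dmax g x)"

lemma dmax_measurable [measurable]:
  assumes [measurable]: "(\<lambda>(x, y). g x y) \<in> borel_measurable (M \<Otimes>\<^sub>M borel)" "h \<in> borel_measurable M"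
  shows "(\<lambda>x. dmax (g x) (h x)) \<in> borel_measurable M"
  unfolding dmax_def by measurable

lemma hlmax_measurable [measurable]:
  assumes [measurable]: "(\<lambda>(x, y). g x y) \<in> borel_measurable (M \<Otimes>\<^sub>M borel)" "h \<in> borel_measurable M"
  shows "(\<lambda>x. hlmax (g x) (h x)) \<in> borel_measurable M"
  unfolding hlmax_def by measurable

lemma avg_le_hlmax:
  fixes g :: "'a::euclidean_space \<Rightarrow> ennreal"
  assumes [measurable]: "g \<in> borel_measurable borel" and r: "0 \<le> r"
  shows "avg g x r \<le> ennreal (2 ^ DIM('a)) * hlmax g x"
proof (cases "r = 0")
  case True
  have "1 * g x \<le> ennreal (2 ^ DIM('a)) * hlmax g x"
    by (rule mult_mono) (auto simp: hlmax_def simp flip: ennreal_1 intro!: ennreal_leI)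
  then show ?thesis using True by simp
next
  case False
  then obtain k where k: "r \<le> 2 powr real_of_int k" "2 powr real_of_int k < 2 * r"
    using ex_dyadic_ge[of r] r by auto
  have "avg g x r \<le> ennreal (2 ^ DIM('a)) * avg g x (2 powr real_of_int k)"
    using k r False by (intro avg_le_superball subset_ball) auto
  also have "\<dots> \<le> ennreal (2 ^ DIM('a)) * hlmax g x"
    by (intro mult_left_mono) (auto simp: hlmax_def dmax_def le_max_iff_disj intro: SUP_upper)
  finally show ?thesis .
qed

text \<open>The factor \<open>6 ^ DIM('a)\<close> comes from Vitali's covering lemma, with the dilation \<open>5\<close>
  enlarged to \<open>6\<close> to pass from closed to open balls.\<close>

lemma dmax_weak_bounded:
  fixes g :: "'a::euclidean_space \<Rightarrow> ennreal"
  assumes [measurable]: "g \<in> borel_measurable borel"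
  shows "l * emeasure lborel {x. \<exists>k\<le>K::int. l < avg g x (2 powr real_of_int k)}
      \<le> ennreal (6 ^ DIM('a)) * (\<integral>\<^sup>+y. g y \<partial>lborel)" (is "l * emeasure lborel ?E \<le> _")
proof -
  have "\<forall>x\<in>?E. \<exists>k. k \<le> K \<and> l < avg g x (2 powr real_of_int k)" by auto
  from bchoice[OF this] obtain k where k: "\<And>x. x \<in> ?E \<Longrightarrow> k x \<le> K \<and> l < avg g x (2 powr real_of_int (k x))"
    by blast
  define r where "r x = 2 powr real_of_int (k x)" for x
  have rpos: "0 < r x" for x by (simp add: r_def)
  obtain C where C: "countable C" "C \<subseteq> ?E"
      "pairwise (\<lambda>i j. disjnt (cball i (r i)) (cball j (r j))) C"
      "?E \<subseteq> (\<Union>i\<in>C. cball i (5 * r i))"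
  \<comment> \<open>The covering lemma asks for uniformly bounded radii; this is the purpose of the
    truncation \<open>k \<le> K\<close>.\<close>
  proof (rule Vitali_covering_lemma_cballs[of ?E "\<lambda>x. x" r ?E "2 powr real_of_int K"])
    show "?E \<subseteq> (\<Union>i\<in>?E. cball i (r i))"
    proof
      fix x assume "x \<in> ?E"
      moreover have "x \<in> cball x (r x)" using rpos[of x] by simp
      ultimately show "x \<in> (\<Union>i\<in>?E. cball i (r i))" by blast
    qed
    show "0 < r i \<and> r i \<le> 2 powr real_of_int K" if "i \<in> ?E" for i
      using k[OF that] rpos by (simp add: r_def)
  qed auto
  have disj: "disjoint_family_on (\<lambda>i. ball i (r i)) C"
    unfolding disjoint_family_on_def
  proof (intro ballI impI)
    fix m n assume "m \<in> C" "n \<in> C" "m \<noteq> n"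
    then have "cball m (r m) \<inter> cball n (r n) = {}"
      using C(3) by (auto simp: pairwise_def disjnt_def)
    then show "ball m (r m) \<inter> ball n (r n) = {}"
      using ball_subset_cball by blast
  qed
  have each: "l * emeasure lborel (ball i (6 * r i)) \<le> ennreal (6 ^ DIM('a)) * (\<integral>\<^sup>+y. g y * indicator (ball i (r i)) y \<partial>lborel)"
    if "i \<in> C" for i
  proof -
    have "l \<le> avg g i (r i)" using k[of i] that C(2) by (auto simp: r_def intro: less_imp_le)
    then have "l * emeasure lborel (ball i (r i)) \<le> avg g i (r i) * emeasure lborel (ball i (r i))"
      by (rule mult_right_mono) simp
    also have "\<dots> = (\<integral>\<^sup>+y. g y * indicator (ball i (r i)) y \<partial>lborel)"
      using rpos[of i] emeasure_ball_pos[of "r i" i] emeasure_ball_finite[of i "r i"]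
      by (simp add: avg_eq ennreal_divide_times less_top)
    finally have "ennreal (6 ^ DIM('a)) * (l * emeasure lborel (ball i (r i)))
        \<le> ennreal (6 ^ DIM('a)) * (\<integral>\<^sup>+y. g y * indicator (ball i (r i)) y \<partial>lborel)"
      by (rule mult_left_mono) simp
    moreover have "emeasure lborel (ball i (6 * r i)) = ennreal (6 ^ DIM('a)) * emeasure lborel (ball i (r i))"
      using rpos[of i] by (simp add: emeasure_ball_scale[of "6 * r i" i] emeasure_ball_scale[of "r i" i] power_mult_distrib ennreal_mult mult.assoc)
    ultimately show ?thesis by (simp add: ac_simps)
  qed
  have sub: "?E \<subseteq> (\<Union>i\<in>C. ball i (6 * r i))"
  proof
    fix x assume "x \<in> ?E"
    then have "x \<in> (\<Union>i\<in>C. cball i (5 * r i))" using C(4) by blast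
    then obtain i where i: "i \<in> C" "dist i x \<le> 5 * r i" by auto
    then have "dist i x < 6 * r i" using rpos[of i] by linarith
    with i show "x \<in> (\<Union>i\<in>C. ball i (6 * r i))" by auto
  qed
  have "emeasure lborel ?E \<le> emeasure lborel (\<Union>i\<in>C. ball i (6 * r i))"
    using C(1) by (intro emeasure_mono sub sets.countable_UN') auto
  also have "\<dots> \<le> (\<integral>\<^sup>+i. emeasure lborel (ball i (6 * r i)) \<partial>count_space C)"
    using C(1) by (intro emeasure_UN_countable_le) auto
  finally have "l * emeasure lborel ?E \<le> l * (\<integral>\<^sup>+i. emeasure lborel (ball i (6 * r i)) \<partial>count_space C)"
    by (rule mult_left_mono) simp
  also have "\<dots> = (\<integral>\<^sup>+i. l * emeasure lborel (ball i (6 * r i)) \<partial>count_space C)"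
    by (simp add: nn_integral_cmult)
  also have "\<dots> \<le> (\<integral>\<^sup>+i. ennreal (6 ^ DIM('a)) * (\<integral>\<^sup>+y. g y * indicator (ball i (r i)) y \<partial>lborel) \<partial>count_space C)"
    using each by (intro nn_integral_mono) auto
  also have "\<dots> = ennreal (6 ^ DIM('a)) * (\<integral>\<^sup>+i. (\<integral>\<^sup>+y. g y * indicator (ball i (r i)) y \<partial>lborel) \<partial>count_space C)"
    by (simp add: nn_integral_cmult)
  also have "\<dots> \<le> ennreal (6 ^ DIM('a)) * (\<integral>\<^sup>+y. g y \<partial>lborel)"
  proof (rule mult_left_mono)
    have "(\<integral>\<^sup>+i. (\<integral>\<^sup>+y. g y * indicator (ball i (r i)) y \<partial>lborel) \<partial>count_space C)
        = (\<integral>\<^sup>+i. emeasure (density lborel g) (ball i (r i)) \<partial>count_space C)"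
      by (simp add: emeasure_density)
    also have "\<dots> = emeasure (density lborel g) (\<Union>i\<in>C. ball i (r i))"
      using C(1) disj by (intro emeasure_UN_countable[symmetric]) auto
    also have "\<dots> \<le> emeasure (density lborel g) (space (density lborel g))"
      by (rule emeasure_space)
    also have "\<dots> = (\<integral>\<^sup>+y. g y \<partial>lborel)"
      by (simp add: emeasure_density)
    finally show "(\<integral>\<^sup>+i. (\<integral>\<^sup>+y. g y * indicator (ball i (r i)) y \<partial>lborel) \<partial>count_space C)
        \<le> (\<integral>\<^sup>+y. g y \<partial>lborel)" .
  qed simp
  finally show ?thesis .
qed

text \<open>The truncated level sets increase with \<open>K\<close> and their bound is independent
  of \<open>K\<close>, so continuity of measure from below removes the truncation.\<close>

lemma dmax_weak:
  fixes g :: "'a::euclidean_space \<Rightarrow> ennreal"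
  assumes [measurable]: "g \<in> borel_measurable borel"
  shows "l * emeasure lborel {x. l < dmax g x} \<le> ennreal (6 ^ DIM('a)) * (\<integral>\<^sup>+y. g y \<partial>lborel)"
proof -
  let ?E = "\<lambda>K::nat. {x. \<exists>k\<le>int K. l < avg g x (2 powr real_of_int k)}"
  have eq: "{x. l < dmax g x} = (\<Union>K. ?E K)"
  proof -
    have "\<exists>K. k \<le> int K" for k using nat_le_iff by blast
    then have "(\<exists>k. l < avg g x (2 powr real_of_int k)) \<longleftrightarrow> (\<exists>K. \<exists>k\<le>int K. l < avg g x (2 powr real_of_int k))" for x
      by blast
    then show ?thesis unfolding dmax_def less_SUP_iff by auto
  qed
  have "emeasure lborel (\<Union>K. ?E K) = (SUP K. emeasure lborel (?E K))"
  proof (rule SUP_emeasure_incseq[symmetric])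
    have "?E K \<in> sets lborel" for K
    proof -
      have "?E K = (\<Union>k\<in>{..int K}. {x. l < avg g x (2 powr real_of_int k)})" by auto
      also have "\<dots> \<in> sets lborel" by (intro sets.countable_UN') (auto intro!: countableI_type)
      finally show ?thesis .
    qed
    then show "range ?E \<subseteq> sets lborel" by auto
    have "?E m \<subseteq> ?E n" if "m \<le> n" for m n
    proof -
      have "int m \<le> int n" using that by simp
      then show ?thesis by (blast intro: order_trans)
    qed
    then show "incseq ?E" by (simp add: incseq_def)
  qed
  then have "l * emeasure lborel {x. l < dmax g x} = (SUP K. l * emeasure lborel (?E K))"
    by (simp add: eq SUP_mult_left_ennreal)
  also have "\<dots> \<le> ennreal (6 ^ DIM('a)) * (\<integral>\<^sup>+y. g y \<partial>lborel)"
    by (intro SUP_least dmax_weak_bounded assms)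
  finally show ?thesis .
qed

text \<open>A discrete layer cake formula, as an inequality. If
  \<open>2^(k-1) < a \<le> 2^k\<close>, the single term \<open>j = k - 1\<close> already dominates
  \<open>a^p\<close>; if \<open>a\<close> is infinite, every \<open>j\<close> is admissible and the
  terms are unbounded.\<close>

lemma layer_cake_dyadic:
  assumes "0 < p"
  shows "ennpowr a p \<le> (\<integral>\<^sup>+j. ennreal (2 powr ((real_of_int j + 1) * p))
      * indicator {j. ennreal (2 powr real_of_int j) < a} j \<partial>count_space UNIV)" (is "_ \<le> ?R")
proof (cases a)
  case (real r)
  show ?thesis
  proof (cases "r = 0")
    case False
    with real have "0 < r" by simp
    then obtain k where k: "r \<le> 2 powr real_of_int k" "2 powr real_of_int k < 2 * r"
      using ex_dyadic_ge by blast
    have lt: "2 powr real_of_int (k - 1) < r"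
      using k by (simp add: powr_diff)
    have "ennpowr a p \<le> ennreal (2 powr ((real_of_int (k - 1) + 1) * p))"
      using real k assms powr_mono2[of p r "2 powr real_of_int k"]
      by (auto simp: ennpowr_ennreal powr_powr intro!: ennreal_leI)
    also have "\<dots> \<le> ?R"
      using nn_integral_count_space_ge[of "\<lambda>j. ennreal (2 powr ((real_of_int j + 1) * p))
          * indicator {j. ennreal (2 powr real_of_int j) < a} j" "k - 1"] lt real by (simp add: ennreal_less_iff)
    finally show ?thesis .
  qed (simp add: real)
next
  case top
  have "of_nat n \<le> ?R" for n
  proof -
    define j where "j = \<lceil>real n / p\<rceil>"
    have "real n / p \<le> real_of_int j" by (simp add: j_def)
    then have "real n \<le> real_of_int j * p" using assms by (simp add: field_simps)
    then have n: "real n \<le> (real_of_int j + 1) * p" using assms by (simp add: field_simps)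
    have "real n \<le> 2 ^ n" using of_nat_less_two_power[of n] by (intro less_imp_le)
    also have "\<dots> = 2 powr real n" by (simp add: powr_realpow)
    also have "\<dots> \<le> 2 powr ((real_of_int j + 1) * p)" using n by (intro powr_mono) auto
    finally have "ennreal (real n) \<le> ennreal (2 powr ((real_of_int j + 1) * p))" by (rule ennreal_leI)
    also have "\<dots> \<le> ?R"
      using nn_integral_count_space_ge[of "\<lambda>j. ennreal (2 powr ((real_of_int j + 1) * p))
          * indicator {j. ennreal (2 powr real_of_int j) < a} j" j] top by simp
    finally show ?thesis by (simp add: ennreal_of_nat_eq_real_of_nat)
  qed
  then have "(SUP n. of_nat n :: ennreal) \<le> ?R" by (rule SUP_least)
  then show ?thesis by (simp only: ennreal_SUP_of_nat_eq_top top_unique top_greatest)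
qed

text \<open>Only \<open>j\<close> with \<open>2^j < 2 a\<close> contribute, and their weights
  \<open>2^(j (p-1))\<close> form a geometric series of size \<open>a^(p-1)\<close>, convergent
  because \<open>p > 1\<close>; the extra factor \<open>a\<close> completes the p-th power.\<close>

lemma layer_cake_dyadic_rev:
  assumes "1 < p"
  shows "(\<integral>\<^sup>+j. ennreal (2 powr (real_of_int j * (p - 1)))
      * (a * indicator {a. ennreal (2 powr (real_of_int j - 1)) < a} a) \<partial>count_space UNIV)
    \<le> ennreal (2 powr (p - 1) / (1 - 2 powr - (p - 1))) * ennpowr a p"
proof (cases a)
  case (real r)
  show ?thesis
  proof (cases "r = 0")
    case False
    with real have r: "0 < r" by simp
    have "(\<integral>\<^sup>+j. ennreal (2 powr (real_of_int j * (p - 1)))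
        * (a * indicator {a. ennreal (2 powr (real_of_int j - 1)) < a} a) \<partial>count_space UNIV)
      \<le> (\<integral>\<^sup>+j. (ennreal (2 powr (real_of_int j * (p - 1))) * indicator {j. 2 powr real_of_int j \<le> 2 * r} j) * a
          \<partial>count_space UNIV)"
      using real r by (intro nn_integral_mono) (auto simp: indicator_def powr_diff ennreal_less_iff)
    also have "\<dots> = (\<integral>\<^sup>+j. ennreal (2 powr (real_of_int j * (p - 1))) * indicator {j. 2 powr real_of_int j \<le> 2 * r} j
          \<partial>count_space UNIV) * a"
      by (rule nn_integral_multc) simp
    also have "\<dots> \<le> ennreal ((2 * r) powr (p - 1) / (1 - 2 powr - (p - 1))) * a"
      using r assms by (intro mult_right_mono dyadic_sum_le) auto
    also have "\<dots> = ennreal ((2 * r) powr (p - 1) / (1 - 2 powr - (p - 1)) * r)"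
      using real r by (subst ennreal_mult'') auto
    also have "(2 * r) powr (p - 1) / (1 - 2 powr - (p - 1)) * r = 2 powr (p - 1) / (1 - 2 powr - (p - 1)) * r powr p"
      using r by (simp add: powr_mult powr_diff)
    also have "ennreal \<dots> = ennreal (2 powr (p - 1) / (1 - 2 powr - (p - 1))) * ennpowr a p"
      using real r by (simp add: ennpowr_ennreal ennreal_mult''[symmetric])
    finally show ?thesis .
  qed (simp add: real)
next
  case top
  have "2 powr - (p - 1) < 1" using assms by (simp add: powr_less_one)
  then have "0 < 2 powr (p - 1) / (1 - 2 powr - (p - 1))" by simp
  then show ?thesis using top assms by (simp add: ennreal_mult_top)
qed

text \<open>Cut \<open>g\<close> at \<open>l = 2^(j-1)\<close>, half of the level considered. The
  part below \<open>l\<close> adds at most \<open>l\<close> to any average, so where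
  \<open>dmax g\<close> exceeds \<open>2 l\<close> the maximal function of the part above
  \<open>l\<close> exceeds \<open>l\<close>. The weak bound is then applied to that part alone, and
  \<open>2 powr (1 - j)\<close> is \<open>1 / l\<close>.\<close>

lemma dmax_weak_truncated:
  fixes g :: "'a::euclidean_space \<Rightarrow> ennreal" and j :: int
  assumes [measurable]: "g \<in> borel_measurable borel"
  shows "emeasure lborel {x. ennreal (2 powr real_of_int j) < dmax g x}
    \<le> ennreal (2 powr (1 - real_of_int j) * 6 ^ DIM('a))
       * (\<integral>\<^sup>+y. g y * indicator {a. ennreal (2 powr (real_of_int j - 1)) < a} (g y) \<partial>lborel)"
proof -
  define l where "l = ennreal (2 powr (real_of_int j - 1))"
  have l2: "ennreal (2 powr real_of_int j) = l + l"
    unfolding l_def by (simp add: powr_diff flip: ennreal_plus)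
  let ?h = "\<lambda>y. g y * indicator {a. l < a} (g y)"
  have "dmax g x \<le> dmax ?h x + l" for x
    unfolding dmax_def[of g]
  proof (rule SUP_least)
    fix k :: int
    have "avg g x (2 powr real_of_int k) \<le> avg (\<lambda>y. ?h y + l) x (2 powr real_of_int k)"
      by (rule avg_mono) (auto simp: indicator_def not_less)
    also have "\<dots> = avg ?h x (2 powr real_of_int k) + l"
      using prob_space_unif_ball[where 'a='a] by (subst avg_add) (auto simp: avg_def)
    also have "\<dots> \<le> dmax ?h x + l"
      by (intro add_right_mono) (auto simp: dmax_def intro: SUP_upper)
    finally show "avg g x (2 powr real_of_int k) \<le> dmax ?h x + l" .
  qed
  then have sub: "{x. ennreal (2 powr real_of_int j) < dmax g x} \<subseteq> {x. l < dmax ?h x}"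
    unfolding l2 by (auto simp: not_less[symmetric]) (meson add_right_mono leI le_less_trans less_irrefl order_trans)
  have inv: "ennreal (2 powr (1 - real_of_int j)) * l = 1"
    unfolding l_def by (simp add: ennreal_mult[symmetric] powr_add[symmetric])
  have "emeasure lborel {x. ennreal (2 powr real_of_int j) < dmax g x} \<le> emeasure lborel {x. l < dmax ?h x}"
    by (intro emeasure_mono sub) measurable
  also have "\<dots> = ennreal (2 powr (1 - real_of_int j)) * (l * emeasure lborel {x. l < dmax ?h x})"
    using inv by (simp add: mult.assoc[symmetric])
  also have "\<dots> \<le> ennreal (2 powr (1 - real_of_int j)) * (ennreal (6 ^ DIM('a)) * (\<integral>\<^sup>+y. ?h y \<partial>lborel))"
    by (intro mult_left_mono dmax_weak) auto
  finally show ?thesis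
    by (simp add: l_def ennreal_mult mult.assoc)
qed

text \<open>Marcinkiewicz interpolation between the weak type bound and the trivial supremum bound,
  carried out over dyadic levels. In \<open>?c\<close>, the power \<open>2 powr (p + 1)\<close> is
  what remains of \<open>2^((j+1) p) * 2^(1-j)\<close> after \<open>2^(j (p-1))\<close> is split
  off; \<open>?d\<close> is the constant of \<open>layer_cake_dyadic_rev\<close>.\<close>

lemma dmax_strong:
  assumes p: "1 < p"
  obtains C :: real where "0 < C"
    "\<And>g :: 'a::euclidean_space \<Rightarrow> ennreal. g \<in> borel_measurable borel \<Longrightarrow>
      (\<integral>\<^sup>+x. ennpowr (dmax g x) p \<partial>lborel) \<le> ennreal C * (\<integral>\<^sup>+x. ennpowr (g x) p \<partial>lborel)"
proof
  let ?c = "2 powr (p + 1) * 6 ^ DIM('a)" and ?d = "2 powr (p - 1) / (1 - 2 powr - (p - 1))"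
  have "2 powr - (p - 1) < 1" using p by (simp add: powr_less_one)
  then have d: "0 < ?d" by simp
  then show "0 < ?c * ?d" by (intro mult_pos_pos) auto
  fix g :: "'a \<Rightarrow> ennreal" assume [measurable]: "g \<in> borel_measurable borel"
  let ?J = "\<lambda>j. indicator {a. ennreal (2 powr (real_of_int j - 1)) < a} :: ennreal \<Rightarrow> ennreal"
  have "(\<integral>\<^sup>+x. ennpowr (dmax g x) p \<partial>lborel)
    \<le> (\<integral>\<^sup>+x. (\<integral>\<^sup>+j. ennreal (2 powr ((real_of_int j + 1) * p))
      * indicator {x. ennreal (2 powr real_of_int j) < dmax g x} x \<partial>count_space UNIV) \<partial>lborel)"
  proof (intro nn_integral_mono)
    fix x
    show "ennpowr (dmax g x) p \<le> (\<integral>\<^sup>+j. ennreal (2 powr ((real_of_int j + 1) * p))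
      * indicator {x. ennreal (2 powr real_of_int j) < dmax g x} x \<partial>count_space UNIV)"
      using layer_cake_dyadic[of p "dmax g x"] p by (simp add: indicator_def)
  qed
  also have "\<dots> = (\<integral>\<^sup>+j. (\<integral>\<^sup>+x. ennreal (2 powr ((real_of_int j + 1) * p))
      * indicator {x. ennreal (2 powr real_of_int j) < dmax g x} x \<partial>lborel) \<partial>count_space UNIV)"
    by (intro nn_integral_count_space_nn_integral) auto
  also have "\<dots> = (\<integral>\<^sup>+j. ennreal (2 powr ((real_of_int j + 1) * p))
      * emeasure lborel {x. ennreal (2 powr real_of_int j) < dmax g x} \<partial>count_space UNIV)"
    by (intro nn_integral_cong) (simp add: nn_integral_cmult)
  also have "\<dots> \<le> (\<integral>\<^sup>+j. ennreal (2 powr ((real_of_int j + 1) * p))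
      * (ennreal (2 powr (1 - real_of_int j) * 6 ^ DIM('a)) * (\<integral>\<^sup>+y. g y * ?J j (g y) \<partial>lborel)) \<partial>count_space UNIV)"
    by (intro nn_integral_mono mult_left_mono dmax_weak_truncated) auto
  also have "\<dots> = (\<integral>\<^sup>+j. ennreal ?c * (\<integral>\<^sup>+y. ennreal (2 powr (real_of_int j * (p - 1))) * (g y * ?J j (g y)) \<partial>lborel) \<partial>count_space UNIV)"
  proof (intro nn_integral_cong)
    fix j :: int
    have "2 powr ((real_of_int j + 1) * p) * (2 powr (1 - real_of_int j) * 6 ^ DIM('a))
        = ?c * 2 powr (real_of_int j * (p - 1))"
      by (simp add: powr_add[symmetric] algebra_simps)
    then have "ennreal (2 powr ((real_of_int j + 1) * p)) * ennreal (2 powr (1 - real_of_int j) * 6 ^ DIM('a))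
        = ennreal ?c * ennreal (2 powr (real_of_int j * (p - 1)))"
      by (simp add: ennreal_mult[symmetric])
    then show "ennreal (2 powr ((real_of_int j + 1) * p))
      * (ennreal (2 powr (1 - real_of_int j) * 6 ^ DIM('a)) * (\<integral>\<^sup>+y. g y * ?J j (g y) \<partial>lborel))
      = ennreal ?c * (\<integral>\<^sup>+y. ennreal (2 powr (real_of_int j * (p - 1))) * (g y * ?J j (g y)) \<partial>lborel)"
      by (subst nn_integral_cmult) (auto simp: mult.assoc[symmetric])
  qed
  also have "\<dots> = ennreal ?c * (\<integral>\<^sup>+j. (\<integral>\<^sup>+y. ennreal (2 powr (real_of_int j * (p - 1))) * (g y * ?J j (g y)) \<partial>lborel) \<partial>count_space UNIV)"
    by (rule nn_integral_cmult) simp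
  also have "\<dots> = ennreal ?c * (\<integral>\<^sup>+y. (\<integral>\<^sup>+j. ennreal (2 powr (real_of_int j * (p - 1))) * (g y * ?J j (g y)) \<partial>count_space UNIV) \<partial>lborel)"
    by (subst nn_integral_count_space_nn_integral) auto
  also have "\<dots> \<le> ennreal ?c * (\<integral>\<^sup>+y. ennreal ?d * ennpowr (g y) p \<partial>lborel)"
    by (intro mult_left_mono nn_integral_mono layer_cake_dyadic_rev p) auto
  also have "\<dots> = ennreal (?c * ?d) * (\<integral>\<^sup>+x. ennpowr (g x) p \<partial>lborel)"
  proof -
    have "ennreal (?c * ?d) = ennreal ?c * ennreal ?d"
      by (rule ennreal_mult) (use d in auto)
    then show ?thesis by (simp only: nn_integral_cmult mult.assoc) (simp add: nn_integral_cmult)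
  qed
  finally show "(\<integral>\<^sup>+x. ennpowr (dmax g x) p \<partial>lborel) \<le> ennreal (?c * ?d) * (\<integral>\<^sup>+x. ennpowr (g x) p \<partial>lborel)" .
qed

theorem hlmax_strong:
  assumes p: "1 < p"
  obtains C :: real where "0 < C"
    "\<And>g :: 'a::euclidean_space \<Rightarrow> ennreal. g \<in> borel_measurable borel \<Longrightarrow>
      (\<integral>\<^sup>+x. ennpowr (hlmax g x) p \<partial>lborel) \<le> ennreal C * (\<integral>\<^sup>+x. ennpowr (g x) p \<partial>lborel)"
proof -
  obtain C :: real where C: "0 < C"
    "\<And>g :: 'a \<Rightarrow> ennreal. g \<in> borel_measurable borel \<Longrightarrow>
      (\<integral>\<^sup>+x. ennpowr (dmax g x) p \<partial>lborel) \<le> ennreal C * (\<integral>\<^sup>+x. ennpowr (g x) p \<partial>lborel)"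
    using dmax_strong[OF p] by metis
  show thesis
  proof (rule that[of "1 + C"])
    fix g :: "'a \<Rightarrow> ennreal" assume [measurable]: "g \<in> borel_measurable borel"
    have "(\<integral>\<^sup>+x. ennpowr (hlmax g x) p \<partial>lborel) \<le> (\<integral>\<^sup>+x. ennpowr (g x) p + ennpowr (dmax g x) p \<partial>lborel)"
      unfolding hlmax_def using p by (intro nn_integral_mono ennpowr_max_le) auto
    also have "\<dots> = (\<integral>\<^sup>+x. ennpowr (g x) p \<partial>lborel) + (\<integral>\<^sup>+x. ennpowr (dmax g x) p \<partial>lborel)"
      by (intro nn_integral_add) auto
    also have "\<dots> \<le> (\<integral>\<^sup>+x. ennpowr (g x) p \<partial>lborel) + ennreal C * (\<integral>\<^sup>+x. ennpowr (g x) p \<partial>lborel)"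
      by (intro add_left_mono C) auto
    also have "\<dots> = ennreal (1 + C) * (\<integral>\<^sup>+x. ennpowr (g x) p \<partial>lborel)"
      using C by (simp add: distrib_right)
    finally show "(\<integral>\<^sup>+x. ennpowr (hlmax g x) p \<partial>lborel) \<le> ennreal (1 + C) * (\<integral>\<^sup>+x. ennpowr (g x) p \<partial>lborel)" .
  qed (use C in auto)
qed

subsection \<open>The strong maximal function on a product\<close>

text \<open>Iterating one-variable maximal functions dominates the averages over products of two
  balls with unrelated radii, which a maximal function over balls of the product space would not
  do.\<close>

definition smax :: "('a::euclidean_space \<Rightarrow> 'b::euclidean_space \<Rightarrow> ennreal) \<Rightarrow> 'a \<Rightarrow> 'b \<Rightarrow> ennreal" where
  "smax F x y = hlmax (\<lambda>u. hlmax (F u) y) x"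

lemma smax_measurable [measurable]:
  assumes [measurable]: "(\<lambda>(x, y). F x y) \<in> borel_measurable (borel \<Otimes>\<^sub>M borel)"
  shows "(\<lambda>(x, y). smax F x y) \<in> borel_measurable (borel \<Otimes>\<^sub>M borel)"
  unfolding smax_def by measurable

lemma avg_avg_le_smax:
  fixes F :: "'a::euclidean_space \<Rightarrow> 'b::euclidean_space \<Rightarrow> ennreal"
  assumes [measurable]: "(\<lambda>(x, y). F x y) \<in> borel_measurable (borel \<Otimes>\<^sub>M borel)"
    and "0 \<le> r" "0 \<le> q"
  shows "avg (\<lambda>u. avg (F u) y q) x r \<le> ennreal (2 ^ (DIM('a) + DIM('b))) * smax F x y"
proof -
  have "avg (\<lambda>u. avg (F u) y q) x r \<le> avg (\<lambda>u. ennreal (2 ^ DIM('b)) * hlmax (F u) y) x r"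
    using assms(3) by (intro avg_mono avg_le_hlmax) measurable
  also have "\<dots> = ennreal (2 ^ DIM('b)) * avg (\<lambda>u. hlmax (F u) y) x r"
    by (rule avg_cmult) measurable
  also have "\<dots> \<le> ennreal (2 ^ DIM('b)) * (ennreal (2 ^ DIM('a)) * hlmax (\<lambda>u. hlmax (F u) y) x)"
    using assms(2) by (intro mult_left_mono avg_le_hlmax) auto
  finally show ?thesis
    by (simp add: smax_def power_add ennreal_mult ac_simps)
qed

text \<open>With the order of integration exchanged, the maximal theorem removes the outer operator
  for fixed \<open>y\<close>; exchanging back, it removes the inner one for fixed
  \<open>x\<close>.\<close>

lemma smax_strong:
  assumes p: "1 < p"
  obtains C :: real where "0 < C"
    "\<And>F :: 'a::euclidean_space \<Rightarrow> 'b::euclidean_space \<Rightarrow> ennreal.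
      (\<lambda>(x, y). F x y) \<in> borel_measurable (borel \<Otimes>\<^sub>M borel) \<Longrightarrow>
      (\<integral>\<^sup>+x. (\<integral>\<^sup>+y. ennpowr (smax F x y) p \<partial>lborel) \<partial>lborel)
        \<le> ennreal C * (\<integral>\<^sup>+x. (\<integral>\<^sup>+y. ennpowr (F x y) p \<partial>lborel) \<partial>lborel)"
proof -
  obtain C :: real where C: "0 < C"
    "\<And>g :: 'a \<Rightarrow> ennreal. g \<in> borel_measurable borel \<Longrightarrow>
      (\<integral>\<^sup>+x. ennpowr (hlmax g x) p \<partial>lborel) \<le> ennreal C * (\<integral>\<^sup>+x. ennpowr (g x) p \<partial>lborel)"
    using hlmax_strong[OF p] by metis
  obtain D :: real where D: "0 < D"
    "\<And>g :: 'b \<Rightarrow> ennreal. g \<in> borel_measurable borel \<Longrightarrow>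
      (\<integral>\<^sup>+x. ennpowr (hlmax g x) p \<partial>lborel) \<le> ennreal D * (\<integral>\<^sup>+x. ennpowr (g x) p \<partial>lborel)"
    using hlmax_strong[OF p] by metis
  show thesis
  proof (rule that[of "C * D"])
    fix F :: "'a \<Rightarrow> 'b \<Rightarrow> ennreal"
    assume [measurable]: "(\<lambda>(x, y). F x y) \<in> borel_measurable (borel \<Otimes>\<^sub>M borel)"
    have "(\<integral>\<^sup>+x. (\<integral>\<^sup>+y. ennpowr (smax F x y) p \<partial>lborel) \<partial>lborel)
        = (\<integral>\<^sup>+y. (\<integral>\<^sup>+x. ennpowr (smax F x y) p \<partial>lborel) \<partial>lborel)"
      by (rule lborel_pair.Fubini') measurable
    also have "\<dots> \<le> (\<integral>\<^sup>+y. ennreal C * (\<integral>\<^sup>+x. ennpowr (hlmax (F x) y) p \<partial>lborel) \<partial>lborel)"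
      unfolding smax_def by (intro nn_integral_mono C) measurable
    also have "\<dots> = ennreal C * (\<integral>\<^sup>+y. (\<integral>\<^sup>+x. ennpowr (hlmax (F x) y) p \<partial>lborel) \<partial>lborel)"
      by (rule nn_integral_cmult) measurable
    also have "(\<integral>\<^sup>+y. (\<integral>\<^sup>+x. ennpowr (hlmax (F x) y) p \<partial>lborel) \<partial>lborel)
        = (\<integral>\<^sup>+x. (\<integral>\<^sup>+y. ennpowr (hlmax (F x) y) p \<partial>lborel) \<partial>lborel)"
      by (rule lborel_pair.Fubini') measurable
    also have "\<dots> \<le> (\<integral>\<^sup>+x. ennreal D * (\<integral>\<^sup>+y. ennpowr (F x y) p \<partial>lborel) \<partial>lborel)"
      by (intro nn_integral_mono D) measurable
    also have "\<dots> = ennreal D * (\<integral>\<^sup>+x. (\<integral>\<^sup>+y. ennpowr (F x y) p \<partial>lborel) \<partial>lborel)"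
      by (rule nn_integral_cmult) measurable
    finally show "(\<integral>\<^sup>+x. (\<integral>\<^sup>+y. ennpowr (smax F x y) p \<partial>lborel) \<partial>lborel)
        \<le> ennreal (C * D) * (\<integral>\<^sup>+x. (\<integral>\<^sup>+y. ennpowr (F x y) p \<partial>lborel) \<partial>lborel)"
      using C D by (simp add: ennreal_mult mult.assoc mult_left_mono)
  qed (use C D in auto)
qed

subsection \<open>Pointwise estimates\<close>

text \<open>The indicators extend the difference by zero to the whole space, where the maximal
  theorems apply.\<close>

definition osc :: "('a \<Rightarrow> real) \<Rightarrow> 'a set \<Rightarrow> 'a \<Rightarrow> 'a \<Rightarrow> ennreal" where
  "osc f G u v = ennreal \<bar>f u - f v\<bar> * indicator G u * indicator G v"

text \<open>For \<open>b = n / p + s\<close> the p-th power is the integrand of the right side of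
  the theorem (\<open>ennpowr_wosc\<close>). On the diagonal the value is 0.\<close>

definition wosc :: "real \<Rightarrow> ('a::real_normed_vector \<Rightarrow> real) \<Rightarrow> 'a set \<Rightarrow> 'a \<Rightarrow> 'a \<Rightarrow> ennreal" where
  "wosc b f G u v = osc f G u v * ennreal (norm (u - v) powr - b)"

lemma osc_measurable [measurable]:
  fixes f :: "'a::euclidean_space \<Rightarrow> real"
  assumes [measurable]: "f \<in> borel_measurable borel" "G \<in> sets borel"
  shows "(\<lambda>(u, v). osc f G u v) \<in> borel_measurable (borel \<Otimes>\<^sub>M borel)"
  unfolding osc_def by measurable

lemma wosc_measurable [measurable]:
  fixes f :: "'a::euclidean_space \<Rightarrow> real"
  assumes [measurable]: "f \<in> borel_measurable borel" "G \<in> sets borel"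
  shows "(\<lambda>(u, v). wosc b f G u v) \<in> borel_measurable (borel \<Otimes>\<^sub>M borel)"
  unfolding wosc_def by measurable

lemma osc_le_wosc:
  assumes "norm (u - v) \<le> l" "0 \<le> b"
  shows "osc f G u v \<le> ennreal (l powr b) * wosc b f G u v"
proof (cases "u = v")
  case False
  then have "norm (u - v) powr b * norm (u - v) powr - b = 1"
    by (simp add: powr_add[symmetric])
  then have "ennreal (norm (u - v) powr b) * ennreal (norm (u - v) powr - b) = 1"
    by (simp add: ennreal_mult[symmetric])
  then have "osc f G u v = ennreal (norm (u - v) powr b) * wosc b f G u v"
    by (simp add: wosc_def mult.left_commute)
  also have "\<dots> \<le> ennreal (l powr b) * wosc b f G u v"
    using assms by (intro mult_right_mono ennreal_leI powr_mono2) auto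
  finally show ?thesis .
qed (simp add: osc_def)

lemma abs_le_add_osc:
  "u \<in> G \<Longrightarrow> v \<in> G \<Longrightarrow> ennreal \<bar>f u\<bar> \<le> ennreal \<bar>f v\<bar> + osc f G u v"
  by (auto simp: osc_def ennreal_plus[symmetric] simp del: ennreal_plus intro!: ennreal_leI)

text \<open>The condition on \<open>w\<close> is essential: outside \<open>G\<close> both terms on
  the right vanish. This forces the intermediate ball in \<open>avg_diff_near\<close> to lie in
  \<open>G\<close>.\<close>

lemma osc_triangle:
  "w \<in> G \<Longrightarrow> osc f G u v \<le> osc f G u w + osc f G v w"
  by (auto simp: osc_def ennreal_plus[symmetric] indicator_def simp del: ennreal_plus intro!: ennreal_leI)

lemma avg_const [simp]: "avg (\<lambda>z. c) (x::'a::euclidean_space) r = c"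
  using prob_space_unif_ball[where 'a='a] by (simp add: avg_def)

lemma avg_mono_ball:
  assumes "\<And>z. norm z < 1 \<Longrightarrow> g (x + r *\<^sub>R z) \<le> h (x + r *\<^sub>R z)"
  shows "avg g x r \<le> avg h x r"
  unfolding avg_def using AE_unif_ball by (intro nn_integral_mono_AE) (auto elim!: eventually_mono assms)

text \<open>For fixed \<open>u\<close> the inequality \<open>|f u| \<le> |f v| + osc f G u v\<close>
  is averaged over \<open>v\<close>, and then over \<open>u\<close>; this double average may use
  different radii. The factor \<open>5 = 1 + 2 + 2\<close> adds up the distance of the centres and
  the two radii, and \<open>4 ^ DIM('a)\<close> is one \<open>2 ^ DIM('a)\<close> for each
  variable.\<close>

lemma avg_diff_far:
  fixes f :: "'a::euclidean_space \<Rightarrow> real"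
  assumes [measurable]: "f \<in> borel_measurable borel" "G \<in> sets borel"
    and x: "\<And>z. norm z < 1 \<Longrightarrow> x + r *\<^sub>R z \<in> G" and y: "\<And>z. norm z < 1 \<Longrightarrow> y + q *\<^sub>R z \<in> G"
    and q: "0 \<le> q" "q \<le> 2 * norm (x - y)" and r: "0 \<le> r" "r \<le> 2 * norm (x - y)" and b: "0 \<le> b"
  shows "avg (\<lambda>u. ennreal \<bar>f u\<bar>) x r \<le> avg (\<lambda>u. ennreal \<bar>f u\<bar>) y q
    + ennreal ((5 * norm (x - y)) powr b) * (ennreal (4 ^ DIM('a)) * smax (wosc b f G) x y)"
proof -
  let ?A = "avg (\<lambda>u. ennreal \<bar>f u\<bar>) y q" and ?c = "ennreal ((5 * norm (x - y)) powr b)"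
  let ?W = "wosc b f G"
  have "ennreal \<bar>f (x + r *\<^sub>R z)\<bar> \<le> ?A + ?c * avg (?W (x + r *\<^sub>R z)) y q" if z: "norm z < 1" for z
  proof -
    let ?u = "x + r *\<^sub>R z"
    have "avg (\<lambda>v. ennreal \<bar>f ?u\<bar>) y q \<le> avg (\<lambda>v. ennreal \<bar>f v\<bar> + ?c * ?W ?u v) y q"
    proof (rule avg_mono_ball)
      fix z' :: 'a assume z': "norm z' < 1"
      let ?v = "y + q *\<^sub>R z'"
      have "?u - ?v = (x - y) + r *\<^sub>R z - q *\<^sub>R z'" by simp
      also have "norm \<dots> \<le> norm (x - y) + norm (r *\<^sub>R z) + norm (q *\<^sub>R z')"
        by (rule order_trans[OF norm_triangle_ineq4]) (intro add_right_mono norm_triangle_ineq)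
      also have "norm (r *\<^sub>R z) \<le> r * 1" unfolding norm_scaleR using r z by (intro mult_mono) auto
      also have "norm (q *\<^sub>R z') \<le> q * 1" unfolding norm_scaleR using q z' by (intro mult_mono) auto
      finally have "norm (?u - ?v) \<le> 5 * norm (x - y)" using r q by linarith
      then have "osc f G ?u ?v \<le> ?c * ?W ?u ?v" using b by (rule osc_le_wosc)
      moreover have "ennreal \<bar>f ?u\<bar> \<le> ennreal \<bar>f ?v\<bar> + osc f G ?u ?v"
        using x[OF z] y[OF z'] by (rule abs_le_add_osc)
      ultimately show "ennreal \<bar>f ?u\<bar> \<le> ennreal \<bar>f ?v\<bar> + ?c * ?W ?u ?v"
        by (meson add_left_mono order_trans)
    qed
    then show ?thesis
      by (simp add: avg_add avg_cmult)
  qed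
  then have "avg (\<lambda>u. ennreal \<bar>f u\<bar>) x r \<le> avg (\<lambda>u. ?A + ?c * avg (?W u) y q) x r"
    by (rule avg_mono_ball)
  also have "\<dots> = ?A + ?c * avg (\<lambda>u. avg (?W u) y q) x r"
    by (simp add: avg_add avg_cmult)
  also have "\<dots> \<le> ?A + ?c * (ennreal (2 ^ (DIM('a) + DIM('a))) * smax ?W x y)"
    using q r by (intro add_left_mono mult_left_mono avg_avg_le_smax) auto
  also have "(2::real) ^ (DIM('a) + DIM('a)) = 4 ^ DIM('a)"
    by (simp add: power_add power_mult_distrib[symmetric])
  finally show ?thesis .
qed

text \<open>The radius has room for \<open>3 t = 2 t + t / 2 + t / 2\<close>: the distance between
  the two compared points, the distance to the intermediate centre, and the radius of the
  intermediate ball. The same radius therefore serves around both points.\<close>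

definition oscavg :: "('a::euclidean_space \<Rightarrow> real) \<Rightarrow> 'a set \<Rightarrow> int \<Rightarrow> 'a \<Rightarrow> ennreal" where
  "oscavg f G k u = avg (osc f G u) u (3 * 2 powr real_of_int k)"

lemma oscavg_measurable [measurable]:
  fixes f :: "'a::euclidean_space \<Rightarrow> real"
  assumes [measurable]: "f \<in> borel_measurable borel" "G \<in> sets borel"
  shows "oscavg f G k \<in> borel_measurable borel"
  unfolding oscavg_def by measurable

text \<open>Both points of a pair in \<open>B(x,r) \<times> B(y,q)\<close> are compared with the points of
  \<open>B(x + (r - t/2)z, t/2)\<close>, which lies in \<open>B(x,r)\<close>, hence in \<open>G\<close>, and has a radius
  comparable to the distance of the pair.\<close>

lemma avg_diff_near:
  fixes f :: "'a::euclidean_space \<Rightarrow> real"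
  assumes [measurable]: "f \<in> borel_measurable borel" "G \<in> sets borel"
    and x: "\<And>z. norm z < 1 \<Longrightarrow> x + r *\<^sub>R z \<in> G" and y: "\<And>z. norm z < 1 \<Longrightarrow> y + q *\<^sub>R z \<in> G"
    and q: "0 \<le> q" "q \<le> r" and t: "0 < t" "r - q \<le> t" "norm (x - y) \<le> t" "t \<le> r"
    and k: "t \<le> 2 powr real_of_int k" "2 powr real_of_int k < 2 * t"
  shows "avg (\<lambda>u. ennreal \<bar>f u\<bar>) x r \<le> avg (\<lambda>u. ennreal \<bar>f u\<bar>) y q
    + ennreal (24 ^ DIM('a)) * (hlmax (oscavg f G k) x + hlmax (oscavg f G k) y)"
proof -
  let ?g = "oscavg f G k" and ?c = "ennreal (12 ^ DIM('a))"
  have pt: "ennreal \<bar>f (x + r *\<^sub>R z)\<bar> \<le> ennreal \<bar>f (y + q *\<^sub>R z)\<bar> + ?c * (?g (x + r *\<^sub>R z) + ?g (y + q *\<^sub>R z))"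
    if z: "norm z < 1" for z
  proof -
    define u v c where "u = x + r *\<^sub>R z" and "v = y + q *\<^sub>R z" and "c = x + (r - t / 2) *\<^sub>R z"
    have uG: "u \<in> G" and vG: "v \<in> G" using x y z by (auto simp: u_def v_def)
    have wG: "w \<in> G" if "w \<in> ball c (t / 2)" for w
    proof -
      have "dist x w \<le> dist x c + dist c w" by (rule dist_triangle)
      also have "dist x c = (r - t / 2) * norm z" using t by (simp add: c_def dist_norm)
      also have "dist c w < t / 2" using that by simp
      also have "(r - t / 2) * norm z \<le> (r - t / 2) * 1" using t z by (intro mult_left_mono) auto
      finally have "dist x w < r" by simp
      then have "norm ((1 / r) *\<^sub>R (w - x)) < 1" using t by (simp add: dist_norm norm_minus_commute)
      from x[OF this] show ?thesis using t by simp
    qed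
    have uc: "dist u c < t / 2"
    proof -
      have "u - c = (t / 2) *\<^sub>R z" by (simp add: u_def c_def algebra_simps)
      then show ?thesis using t z by (simp add: dist_norm)
    qed
    have uv: "dist v u \<le> 2 * t"
    proof -
      have "v - u = (y - x) - (r - q) *\<^sub>R z" by (simp add: u_def v_def algebra_simps)
      then have "dist v u \<le> norm (y - x) + norm ((r - q) *\<^sub>R z)" by (simp only: dist_norm norm_triangle_ineq4)
      also have "norm ((r - q) *\<^sub>R z) \<le> t * 1" unfolding norm_scaleR using q z t by (intro mult_mono) auto
      finally show ?thesis using t by (simp add: norm_minus_commute)
    qed
    have sub: "ball c (t / 2) \<subseteq> ball a (3 * 2 powr real_of_int k)" if "dist a u \<le> 2 * t" for a
    proof
      fix w assume "w \<in> ball c (t / 2)"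
      then have "dist a w < 3 * t"
        using that uc dist_triangle[of a w u] dist_triangle[of u w c] by simp
      then show "w \<in> ball a (3 * 2 powr real_of_int k)" using k by simp
    qed
    have "osc f G u v = avg (\<lambda>w. osc f G u v) c (t / 2)" by simp
    also have "\<dots> \<le> avg (\<lambda>w. osc f G u w + osc f G v w) c (t / 2)"
    proof (rule avg_mono_ball)
      fix z :: 'a assume "norm z < 1"
      then have "c + (t / 2) *\<^sub>R z \<in> ball c (t / 2)" using t by (simp add: dist_norm)
      then show "osc f G u v \<le> osc f G u (c + (t / 2) *\<^sub>R z) + osc f G v (c + (t / 2) *\<^sub>R z)"
        by (intro osc_triangle wG)
    qed
    also have "\<dots> = avg (osc f G u) c (t / 2) + avg (osc f G v) c (t / 2)"
      by (rule avg_add) auto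
    \<comment> \<open>The large radius \<open>3 * 2^k\<close> is less than \<open>6 t\<close>, that
      is, twelve times the intermediate radius \<open>t / 2\<close>; hence the base
      \<open>12\<close>.\<close>
    also have "\<dots> \<le> ?c * ?g u + ?c * ?g v"
      unfolding oscavg_def using t k uv
      by (intro add_mono avg_le_superball sub) auto
    finally have "osc f G u v \<le> ?c * (?g u + ?g v)" by (simp add: distrib_left)
    with abs_le_add_osc[OF uG vG, of f] have "ennreal \<bar>f u\<bar> \<le> ennreal \<bar>f v\<bar> + ?c * (?g u + ?g v)"
      by (meson add_left_mono order_trans)
    then show ?thesis by (simp add: u_def v_def)
  qed
  \<comment> \<open>Both sides are integrated over the common parameter \<open>z\<close>. Averages
    of \<open>oscavg\<close> remain, and bounding them by \<open>hlmax\<close> turns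
    \<open>12\<close> into \<open>24 = 12 * 2\<close>.\<close>
  have "avg (\<lambda>u. ennreal \<bar>f u\<bar>) x r
      \<le> (\<integral>\<^sup>+z. ennreal \<bar>f (y + q *\<^sub>R z)\<bar> + ?c * (?g (x + r *\<^sub>R z) + ?g (y + q *\<^sub>R z)) \<partial>unif_ball)"
    unfolding avg_def using AE_unif_ball by (intro nn_integral_mono_AE) (auto elim!: eventually_mono pt)
  also have "\<dots> = avg (\<lambda>u. ennreal \<bar>f u\<bar>) y q + ?c * (avg ?g x r + avg ?g y q)"
    unfolding avg_def by (simp add: nn_integral_add nn_integral_cmult)
  also have "\<dots> \<le> avg (\<lambda>u. ennreal \<bar>f u\<bar>) y q
      + ?c * (ennreal (2 ^ DIM('a)) * hlmax ?g x + ennreal (2 ^ DIM('a)) * hlmax ?g y)"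
    using q t by (intro add_left_mono mult_left_mono add_mono avg_le_hlmax) auto
  also have "?c * (ennreal (2 ^ DIM('a)) * hlmax ?g x + ennreal (2 ^ DIM('a)) * hlmax ?g y)
      = ennreal (24 ^ DIM('a)) * (hlmax ?g x + hlmax ?g y)"
    by (simp add: distrib_left[symmetric] mult.assoc[symmetric] ennreal_mult[symmetric] power_mult_distrib[symmetric])
  finally show ?thesis .
qed

text \<open>Scale \<open>k\<close> serves only pairs with \<open>|x - y| \<le> t \<le> 2^k\<close>.
  The cutoff records this and makes the kernel integrable in each variable.\<close>

definition near_kernel :: "real \<Rightarrow> int \<Rightarrow> 'a::euclidean_space \<Rightarrow> 'a \<Rightarrow> ennreal" where
  "near_kernel \<epsilon> k x y = ennreal (norm (x - y) powr (\<epsilon> - real DIM('a)))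
     * indicator {h. norm h \<le> 2 powr real_of_int k} (x - y)"

text \<open>The scale \<open>k\<close> picked for a pair of points depends on the radius
  \<open>r\<close>. Summing over all \<open>k\<close> removes this dependence, so the bound survives
  the supremum in \<open>max_op\<close> and involves \<open>R\<close> no longer.\<close>

definition majorant :: "real \<Rightarrow> real \<Rightarrow> real \<Rightarrow> ('a::euclidean_space \<Rightarrow> real) \<Rightarrow> 'a set \<Rightarrow> 'a \<Rightarrow> 'a \<Rightarrow> ennreal" where
  "majorant p \<epsilon> s f G x y = ennpowr (smax (wosc (real DIM('a) / p + s) f G) x y) p
     + (\<integral>\<^sup>+k. ennreal (2 powr (- real_of_int k * (\<epsilon> + s * p))) * near_kernel \<epsilon> k x y
          * (ennpowr (hlmax (oscavg f G k) x) p + ennpowr (hlmax (oscavg f G k) y) p) \<partial>count_space UNIV)"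

text \<open>The error \<open>c\<close> varies with \<open>r\<close> and \<open>q\<close>, but the
  bound on its weighted p-th power does not. Here \<delta> stands for
  \<open>|x - y| + |R x - R y|\<close>.\<close>

lemma pointwise_bound:
  fixes x y :: "'a::euclidean_space"
  assumes p: "1 < p" and \<epsilon>: "0 < \<epsilon>" "\<epsilon> < 1" and s: "0 < s" "s < 1"
    and [measurable]: "f \<in> borel_measurable borel" "G \<in> sets borel"
    and x: "\<And>z. norm z < 1 \<Longrightarrow> x + r *\<^sub>R z \<in> G" and y: "\<And>z. norm z < 1 \<Longrightarrow> y + q *\<^sub>R z \<in> G"
    and q: "0 \<le> q" "q \<le> r" and \<delta>: "norm (x - y) \<le> \<delta>" "r - q \<le> \<delta>" and xy: "x \<noteq> y"
  obtains c where "avg (\<lambda>u. ennreal \<bar>f u\<bar>) x r \<le> avg (\<lambda>u. ennreal \<bar>f u\<bar>) y q + c"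
    "ennpowr c p * ennreal (\<delta> powr - (\<epsilon> + s * p) * norm (x - y) powr (\<epsilon> - real DIM('a)))
      \<le> ennreal (5 powr (real DIM('a) + p) * 24 powr (real DIM('a) * p) * 2 powr (1 + 2 * p)) * majorant p \<epsilon> s f G x y"
proof -
  let ?N = "real DIM('a)" and ?\<rho> = "norm (x - y)"
  let ?w = "ennreal (\<delta> powr - (\<epsilon> + s * p) * ?\<rho> powr (\<epsilon> - ?N))"
  \<comment> \<open>One constant for both cases: it dominates the factor in \<open>C1\<close> from
    the far case and that in \<open>C2\<close> from the near case. The bounds \<open>s < 1\<close>
    and \<open>\<epsilon> < 1\<close> make it independent of both parameters.\<close>
  let ?C = "5 powr (?N + p) * 24 powr (?N * p) * 2 powr (1 + 2 * p)"
  have \<rho>: "0 < ?\<rho>" using xy by simp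
  have sp: "s * p < p" "0 < s * p" using s p by auto
  have C1: "5 powr (?N + s * p) * 4 powr (?N * p) \<le> ?C * 1"
  proof -
    have "5 powr (?N + s * p) * 4 powr (?N * p) \<le> 5 powr (?N + p) * 24 powr (?N * p)"
      using p sp by (intro mult_mono powr_mono powr_mono2) auto
    also have "\<dots> * 1 \<le> 5 powr (?N + p) * 24 powr (?N * p) * 2 powr (1 + 2 * p)"
      using p by (intro mult_left_mono) (auto intro: ge_one_powr_ge_zero)
    finally show ?thesis by simp
  qed
  have C2: "24 powr (?N * p) * 2 powr p * 2 powr (\<epsilon> + s * p) \<le> ?C * 1"
  proof -
    have "24 powr (?N * p) * 2 powr p * 2 powr (\<epsilon> + s * p) = 24 powr (?N * p) * 2 powr (p + \<epsilon> + s * p)"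
      by (simp add: powr_add)
    also have "\<dots> \<le> 24 powr (?N * p) * 2 powr (1 + 2 * p)"
      using sp \<epsilon> by (intro mult_left_mono powr_mono) auto
    also have "\<dots> \<le> 5 powr (?N + p) * (24 powr (?N * p) * 2 powr (1 + 2 * p))"
      using p mult_right_mono[of 1 "5 powr (?N + p)" "24 powr (?N * p) * 2 powr (1 + 2 * p)"]
      by (simp add: ge_one_powr_ge_zero)
    finally show ?thesis by (simp add: mult.assoc)
  qed
  show thesis
  proof (cases "r \<le> 2 * ?\<rho>")
    case True
    let ?b = "?N / p + s" and ?S = "smax (wosc (?N / p + s) f G) x y"
    let ?c = "ennreal ((5 * ?\<rho>) powr ?b) * (ennreal (4 ^ DIM('a)) * ?S)"
    show thesis
    proof (rule that[of ?c])
      show "avg (\<lambda>u. ennreal \<bar>f u\<bar>) x r \<le> avg (\<lambda>u. ennreal \<bar>f u\<bar>) y q + ?c"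
        using True q x y p s by (intro avg_diff_far) auto
      have bp: "?b * p = ?N + s * p" using p by (simp add: field_simps)
      have "ennpowr ?c p = ennreal ((5 * ?\<rho>) powr (?N + s * p) * 4 powr (?N * p)) * ennpowr ?S p"
        using p by (simp add: ennpowr_mult ennpowr_ennreal powr_powr bp ennreal_mult mult.assoc powr_realpow[symmetric])
      then have "ennpowr ?c p * ?w = ennreal ((5 * ?\<rho>) powr (?N + s * p) * 4 powr (?N * p)
           * (\<delta> powr - (\<epsilon> + s * p) * ?\<rho> powr (\<epsilon> - ?N))) * ennpowr ?S p"
        by (simp add: ennreal_mult ac_simps)
      also have "\<dots> \<le> ennreal ?C * ennpowr ?S p"
      proof (intro mult_right_mono ennreal_leI)
        \<comment> \<open>Since \<delta> is at least \<open>?\<rho>\<close>, the weight is at most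
          \<open>?\<rho> powr - (?N + s * p)\<close>, which cancels the power of
          \<open>?\<rho>\<close> contained in \<open>ennpowr ?c p\<close>.\<close>
        have "\<delta> powr - (\<epsilon> + s * p) \<le> ?\<rho> powr - (\<epsilon> + s * p)"
          using \<rho> \<delta> \<epsilon> sp by (intro powr_mono2') auto
        then have "\<delta> powr - (\<epsilon> + s * p) * ?\<rho> powr (\<epsilon> - ?N) \<le> ?\<rho> powr - (\<epsilon> + s * p) * ?\<rho> powr (\<epsilon> - ?N)"
          by (rule mult_right_mono) simp
        also have "\<dots> = ?\<rho> powr - (?N + s * p)"
        proof -
          have "- (\<epsilon> + s * p) + (\<epsilon> - ?N) = - (?N + s * p)" by simp
          then show ?thesis by (simp only: powr_add[symmetric])
        qed
        finally have "(5 * ?\<rho>) powr (?N + s * p) * 4 powr (?N * p) * (\<delta> powr - (\<epsilon> + s * p) * ?\<rho> powr (\<epsilon> - ?N))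
            \<le> (5 * ?\<rho>) powr (?N + s * p) * 4 powr (?N * p) * ?\<rho> powr - (?N + s * p)"
          by (rule mult_left_mono) simp
        also have "\<dots> = 5 powr (?N + s * p) * 4 powr (?N * p) * (?\<rho> powr (?N + s * p) * ?\<rho> powr - (?N + s * p))"
          by (simp add: powr_mult)
        also have "?\<rho> powr (?N + s * p) * ?\<rho> powr - (?N + s * p) = 1"
          using \<rho> by (simp only: powr_add[symmetric]) simp
        finally show "(5 * ?\<rho>) powr (?N + s * p) * 4 powr (?N * p) * (\<delta> powr - (\<epsilon> + s * p) * ?\<rho> powr (\<epsilon> - ?N)) \<le> ?C"
          using C1 by linarith
      qed simp
      also have "\<dots> \<le> ennreal ?C * majorant p \<epsilon> s f G x y"
        unfolding majorant_def by (intro mult_left_mono) auto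
      finally show "ennpowr ?c p * ?w \<le> ennreal ?C * majorant p \<epsilon> s f G x y" .
    qed
  next
    case False
    define t where "t = max (r - q) ?\<rho>"
    have t: "0 < t" "r - q \<le> t" "?\<rho> \<le> t" "t \<le> r" "t \<le> \<delta>"
      using False \<rho> q \<delta> by (auto simp: t_def less_max_iff_disj)
    obtain k where k: "t \<le> 2 powr real_of_int k" "2 powr real_of_int k < 2 * t"
      using ex_dyadic_ge[OF t(1)] by blast
    let ?X = "hlmax (oscavg f G k) x" and ?Y = "hlmax (oscavg f G k) y"
    let ?c = "ennreal (24 ^ DIM('a)) * (?X + ?Y)"
    show thesis
    proof (rule that[of ?c])
      show "avg (\<lambda>u. ennreal \<bar>f u\<bar>) x r \<le> avg (\<lambda>u. ennreal \<bar>f u\<bar>) y q + ?c"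
        using q x y t k by (intro avg_diff_near) auto
      let ?P = "ennpowr ?X p + ennpowr ?Y p"
      let ?T = "ennreal (2 powr (- real_of_int k * (\<epsilon> + s * p))) * near_kernel \<epsilon> k x y * ?P"
      have "ennpowr ?c p = ennreal (24 powr (?N * p)) * ennpowr (?X + ?Y) p"
        using p by (simp add: ennpowr_mult ennpowr_ennreal powr_powr powr_realpow[symmetric])
      also have "\<dots> \<le> ennreal (24 powr (?N * p)) * (ennreal (2 powr p) * ?P)"
        using p by (intro mult_left_mono ennpowr_add_le) auto
      finally have "ennpowr ?c p * ?w \<le> ennreal (24 powr (?N * p)) * (ennreal (2 powr p) * ?P) * ?w"
        by (rule mult_right_mono) simp
      also have "\<dots> = ennreal (24 powr (?N * p) * 2 powr p * (\<delta> powr - (\<epsilon> + s * p) * ?\<rho> powr (\<epsilon> - ?N))) * ?P"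
        by (simp add: ennreal_mult ac_simps)
      also have "\<dots> \<le> ennreal (?C * (2 powr (- real_of_int k * (\<epsilon> + s * p)) * ?\<rho> powr (\<epsilon> - ?N))) * ?P"
      proof (intro mult_right_mono ennreal_leI)
        \<comment> \<open>Here \<open>\<delta> \<ge> t > 2^k / 2\<close> and the exponent is
          negative; the halving produces the factor \<open>2 powr (\<epsilon> + s * p)\<close>
          absorbed in \<open>C2\<close>.\<close>
        have "\<delta> powr - (\<epsilon> + s * p) \<le> (2 powr real_of_int k / 2) powr - (\<epsilon> + s * p)"
          using k t \<epsilon> sp by (intro powr_mono2') auto
        also have "\<dots> = 2 powr (\<epsilon> + s * p) * 2 powr (- real_of_int k * (\<epsilon> + s * p))"
        proof -
          have "2 powr real_of_int k / 2 = 2 powr (real_of_int k - 1)" by (simp add: powr_diff)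
          moreover have "(real_of_int k - 1) * - (\<epsilon> + s * p) = (\<epsilon> + s * p) + - real_of_int k * (\<epsilon> + s * p)"
            by (simp add: algebra_simps)
          ultimately show ?thesis by (simp only: powr_powr powr_add)
        qed
        finally have "24 powr (?N * p) * 2 powr p * (\<delta> powr - (\<epsilon> + s * p) * ?\<rho> powr (\<epsilon> - ?N))
          \<le> 24 powr (?N * p) * 2 powr p * (2 powr (\<epsilon> + s * p) * 2 powr (- real_of_int k * (\<epsilon> + s * p)) * ?\<rho> powr (\<epsilon> - ?N))"
          by (intro mult_left_mono mult_right_mono) auto
        also have "\<dots> = (24 powr (?N * p) * 2 powr p * 2 powr (\<epsilon> + s * p)) * (2 powr (- real_of_int k * (\<epsilon> + s * p)) * ?\<rho> powr (\<epsilon> - ?N))"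
          by (simp only: mult.assoc)
        also have "\<dots> \<le> ?C * (2 powr (- real_of_int k * (\<epsilon> + s * p)) * ?\<rho> powr (\<epsilon> - ?N))"
          using C2 by (intro mult_right_mono) auto
        finally show "24 powr (?N * p) * 2 powr p * (\<delta> powr - (\<epsilon> + s * p) * ?\<rho> powr (\<epsilon> - ?N))
          \<le> ?C * (2 powr (- real_of_int k * (\<epsilon> + s * p)) * ?\<rho> powr (\<epsilon> - ?N))" .
      qed simp
      also have "\<dots> = ennreal ?C * ?T"
      proof -
        have "?\<rho> \<le> 2 powr real_of_int k" using t k by linarith
        then have "near_kernel \<epsilon> k x y = ennreal (?\<rho> powr (\<epsilon> - ?N))"
          by (simp add: near_kernel_def)
        then show ?thesis by (simp add: ennreal_mult mult.assoc)
      qed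
      also have "\<dots> \<le> ennreal ?C * majorant p \<epsilon> s f G x y"
        unfolding majorant_def
        by (intro mult_left_mono add_increasing
            nn_integral_count_space_ge[of "\<lambda>k. ennreal (2 powr (- real_of_int k * (\<epsilon> + s * p))) * near_kernel \<epsilon> k x y
          * (ennpowr (hlmax (oscavg f G k) x) p + ennpowr (hlmax (oscavg f G k) y) p)"]) auto
      finally show "ennpowr ?c p * ?w \<le> ennreal ?C * majorant p \<epsilon> s f G x y" .
    qed
  qed
qed

subsection \<open>Integrating the majorant\<close>

lemma two_powr_power: "(2 powr a) ^ n = 2 powr (a * real n)" for a :: real
  by (subst powr_realpow[symmetric]) (auto simp: powr_powr)

lemma nn_integral_swap_int:
  fixes F :: "int \<Rightarrow> 'b \<Rightarrow> ennreal"
  assumes "\<And>k. F k \<in> borel_measurable M"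
  shows "(\<integral>\<^sup>+x. (\<integral>\<^sup>+k. F k x \<partial>count_space UNIV) \<partial>M) = (\<integral>\<^sup>+k. (\<integral>\<^sup>+x. F k x \<partial>M) \<partial>count_space UNIV)"
  using assms by (intro nn_integral_count_space_nn_integral) auto

lemma borel_measurable_nn_integral_int [measurable (raw)]:
  fixes F :: "int \<Rightarrow> 'b \<Rightarrow> ennreal"
  assumes [measurable]: "\<And>k. F k \<in> borel_measurable M"
  shows "(\<lambda>x. \<integral>\<^sup>+k. F k x \<partial>count_space UNIV) \<in> borel_measurable M"
proof -
  have "(\<integral>\<^sup>+k. F k x \<partial>count_space UNIV) = (\<Sum>i. F (from_nat_into UNIV i) x)" for x
    using nn_integral_bij_count_space[OF bij_betw_from_nat_into[of "UNIV :: int set"], of "\<lambda>k. F k x"]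
    by (simp add: nn_integral_count_space_nat infinite_UNIV_int)
  then show ?thesis by simp
qed

lemma nn_integral_cmult2:
  fixes F :: "'a::euclidean_space \<Rightarrow> 'b::euclidean_space \<Rightarrow> ennreal"
  assumes [measurable]: "(\<lambda>(x, y). F x y) \<in> borel_measurable (borel \<Otimes>\<^sub>M borel)"
  shows "(\<integral>\<^sup>+x. (\<integral>\<^sup>+y. c * F x y \<partial>lborel) \<partial>lborel) = c * (\<integral>\<^sup>+x. (\<integral>\<^sup>+y. F x y \<partial>lborel) \<partial>lborel)"
  by (simp add: nn_integral_cmult)

lemma nn_integral_add2:
  fixes F H :: "'a::euclidean_space \<Rightarrow> 'b::euclidean_space \<Rightarrow> ennreal"
  assumes [measurable]: "(\<lambda>(x, y). F x y) \<in> borel_measurable (borel \<Otimes>\<^sub>M borel)"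
    "(\<lambda>(x, y). H x y) \<in> borel_measurable (borel \<Otimes>\<^sub>M borel)"
  shows "(\<integral>\<^sup>+x. (\<integral>\<^sup>+y. F x y + H x y \<partial>lborel) \<partial>lborel)
    = (\<integral>\<^sup>+x. (\<integral>\<^sup>+y. F x y \<partial>lborel) \<partial>lborel) + (\<integral>\<^sup>+x. (\<integral>\<^sup>+y. H x y \<partial>lborel) \<partial>lborel)"
  by (simp add: nn_integral_add)

lemma nn_integral_swap_int2:
  fixes F :: "int \<Rightarrow> 'a::euclidean_space \<Rightarrow> 'b::euclidean_space \<Rightarrow> ennreal"
  assumes F [measurable]: "\<And>k. (\<lambda>(x, y). F k x y) \<in> borel_measurable (borel \<Otimes>\<^sub>M borel)"
  shows "(\<integral>\<^sup>+k. (\<integral>\<^sup>+x. (\<integral>\<^sup>+y. F k x y \<partial>lborel) \<partial>lborel) \<partial>count_space UNIV)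
    = (\<integral>\<^sup>+x. (\<integral>\<^sup>+y. (\<integral>\<^sup>+k. F k x y \<partial>count_space UNIV) \<partial>lborel) \<partial>lborel)"
proof -
  have "(\<integral>\<^sup>+x. (\<integral>\<^sup>+y. (\<integral>\<^sup>+k. F k x y \<partial>count_space UNIV) \<partial>lborel) \<partial>lborel)
      = (\<integral>\<^sup>+x. (\<integral>\<^sup>+k. (\<integral>\<^sup>+y. F k x y \<partial>lborel) \<partial>count_space UNIV) \<partial>lborel)"
    by (intro nn_integral_cong nn_integral_swap_int) measurable
  also have "\<dots> = (\<integral>\<^sup>+k. (\<integral>\<^sup>+x. (\<integral>\<^sup>+y. F k x y \<partial>lborel) \<partial>lborel) \<partial>count_space UNIV)"
    by (rule nn_integral_swap_int) measurable
  finally show ?thesis by (rule sym)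
qed

lemma emeasure_ball_content:
  fixes x :: "'a::euclidean_space"
  assumes "0 \<le> r"
  shows "emeasure lborel (ball x r) = ennreal (r ^ DIM('a) * measure lborel (ball (0::'a) 1))"
proof -
  have "emeasure lborel (ball (0::'a) 1) = ennreal (measure lborel (ball (0::'a) 1))"
    using emeasure_ball_finite by (intro emeasure_eq_ennreal_measure) auto
  then show ?thesis
    using assms by (simp only: emeasure_ball_scale[OF assms, of x] ennreal_mult zero_le_power measure_nonneg)
qed

lemma near_kernel_measurable [measurable]:
  "(\<lambda>(x, y). near_kernel \<epsilon> k x (y :: 'a::euclidean_space)) \<in> borel_measurable (borel \<Otimes>\<^sub>M borel)"
proof -
  have [measurable]: "{h::'a. norm h \<le> 2 powr real_of_int k} \<in> sets borel" by measurable
  show ?thesis unfolding near_kernel_def by measurable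
qed

lemma near_kernel_commute: "near_kernel \<epsilon> k x y = near_kernel \<epsilon> k y x"
  by (simp add: near_kernel_def norm_minus_commute indicator_def)

text \<open>Dyadic decomposition of the singularity. On the shell
  \<open>2^j / 2 < |x - y| \<le> 2^j\<close> the negative power is at most its value at
  \<open>2^j / 2\<close>, and the shell is relaxed to a ball. The cutoff gives
  \<open>2^j < 2 |x - y| \<le> 2 * 2^k\<close>. At \<open>x = y\<close> the kernel is 0, since
  \<open>0 powr a = 0\<close>.\<close>

lemma near_kernel_le:
  fixes x y :: "'a::euclidean_space"
  assumes "\<epsilon> < 1"
  shows "near_kernel \<epsilon> k x y \<le> (\<integral>\<^sup>+j. ennreal (2 powr (real DIM('a) - \<epsilon>) * 2 powr (real_of_int j * (\<epsilon> - real DIM('a))))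
      * indicator {j. 2 powr real_of_int j \<le> 2 * 2 powr real_of_int k} j
      * indicator (ball x (2 * 2 powr real_of_int j)) y \<partial>count_space UNIV)" (is "_ \<le> (\<integral>\<^sup>+j. ?h j \<partial>_)")
proof (cases "x \<noteq> y \<and> norm (x - y) \<le> 2 powr real_of_int k")
  case True
  let ?N = "real DIM('a)"
  have N: "1 \<le> ?N" using DIM_ge_Suc0[where 'a='a] by simp
  have "0 < norm (x - y)" using True by simp
  then obtain j where j: "norm (x - y) \<le> 2 powr real_of_int j" "2 powr real_of_int j < 2 * norm (x - y)"
    using ex_dyadic_ge by blast
  have "norm (x - y) powr (\<epsilon> - ?N) \<le> (2 powr real_of_int j / 2) powr (\<epsilon> - ?N)"
  proof (rule powr_mono2')
    show "\<epsilon> - ?N \<le> 0" using assms N by linarith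
  qed (use j in auto)
  also have "\<dots> = 2 powr (?N - \<epsilon>) * 2 powr (real_of_int j * (\<epsilon> - ?N))"
    by (simp add: powr_divide powr_powr) (simp add: powr_diff field_simps)
  finally have "near_kernel \<epsilon> k x y \<le> ennreal (2 powr (?N - \<epsilon>) * 2 powr (real_of_int j * (\<epsilon> - ?N)))"
    using True by (simp add: near_kernel_def ennreal_leI)
  also have "\<dots> = ?h j"
  proof -
    have "dist x y < 2 * 2 powr real_of_int j"
      using j powr_gt_zero[of 2 "real_of_int j"] by (simp add: dist_norm del: powr_gt_zero)
    moreover have "2 powr real_of_int j \<le> 2 * 2 powr real_of_int k" using j True by linarith
    ultimately show ?thesis by simp
  qed
  also have "\<dots> \<le> (\<integral>\<^sup>+j. ?h j \<partial>count_space UNIV)"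
    by (rule nn_integral_count_space_ge)
  finally show ?thesis .
qed (auto simp: near_kernel_def)

text \<open>The ball at level \<open>j\<close> has volume of order \<open>2^(j n)\<close>, so its
  contribution is of order \<open>2^(j \<epsilon>)\<close>; summed over \<open>j \<le> k + 1\<close>
  this converges because \<open>\<epsilon> > 0\<close>.\<close>

lemma near_kernel_integral:
  assumes \<epsilon>: "0 < \<epsilon>" "\<epsilon> < 1"
  obtains C :: real where "0 < C"
    "\<And>k (x::'a::euclidean_space). (\<integral>\<^sup>+y. near_kernel \<epsilon> k x y \<partial>lborel) \<le> ennreal (C * 2 powr (real_of_int k * \<epsilon>))"
proof
  let ?N = "real DIM('a)" and ?\<omega> = "measure lborel (ball (0::'a) 1)"
  let ?A = "2 powr (?N - \<epsilon>)"
  have e1: "2 powr - \<epsilon> < 1" using \<epsilon> by (simp add: powr_less_one)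
  have \<omega>: "0 < ?\<omega>" by simp
  show "0 < ?A * 2 powr ?N * ?\<omega> * (2 powr \<epsilon> / (1 - 2 powr - \<epsilon>))"
    using e1 \<omega> by (intro mult_pos_pos) auto
  fix k and x :: 'a
  let ?I = "\<lambda>j. indicator {j. 2 powr real_of_int j \<le> 2 * 2 powr real_of_int k} (j::int) :: ennreal"
  have "(\<integral>\<^sup>+y. near_kernel \<epsilon> k x y \<partial>lborel)
     \<le> (\<integral>\<^sup>+y. (\<integral>\<^sup>+j. ennreal (?A * 2 powr (real_of_int j * (\<epsilon> - ?N))) * ?I j
      * indicator (ball x (2 * 2 powr real_of_int j)) y \<partial>count_space UNIV) \<partial>lborel)"
    by (intro nn_integral_mono near_kernel_le \<epsilon>)
  also have "\<dots> = (\<integral>\<^sup>+j. (\<integral>\<^sup>+y. ennreal (?A * 2 powr (real_of_int j * (\<epsilon> - ?N))) * ?I j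
      * indicator (ball x (2 * 2 powr real_of_int j)) y \<partial>lborel) \<partial>count_space UNIV)"
    by (intro nn_integral_swap_int borel_measurable_times_ennreal borel_measurable_const borel_measurable_indicator) simp
  also have "\<dots> = (\<integral>\<^sup>+j. ennreal (?A * 2 powr ?N * ?\<omega>) * (ennreal (2 powr (real_of_int j * \<epsilon>)) * ?I j) \<partial>count_space UNIV)"
  proof (intro nn_integral_cong)
    fix j :: int
    have "emeasure lborel (ball x (2 * 2 powr real_of_int j)) = ennreal ((2 * 2 powr real_of_int j) ^ DIM('a) * ?\<omega>)"
      by (rule emeasure_ball_content) simp
    also have "(2 * 2 powr real_of_int j) ^ DIM('a) = 2 powr ?N * 2 powr (real_of_int j * ?N)"
      by (simp only: power_mult_distrib two_powr_power) (simp add: powr_realpow)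
    finally have vol: "emeasure lborel (ball x (2 * 2 powr real_of_int j)) = ennreal (2 powr ?N * 2 powr (real_of_int j * ?N) * ?\<omega>)" .
    have "(\<integral>\<^sup>+y. ennreal (?A * 2 powr (real_of_int j * (\<epsilon> - ?N))) * ?I j
      * indicator (ball x (2 * 2 powr real_of_int j)) y \<partial>lborel)
      = ennreal (?A * 2 powr (real_of_int j * (\<epsilon> - ?N))) * ?I j * ennreal (2 powr ?N * 2 powr (real_of_int j * ?N) * ?\<omega>)"
      by (subst nn_integral_cmult_indicator) (auto simp: vol)
    also have "\<dots> = ennreal (?A * 2 powr (real_of_int j * (\<epsilon> - ?N)) * (2 powr ?N * 2 powr (real_of_int j * ?N) * ?\<omega>)) * ?I j"
      by (simp add: ennreal_mult ac_simps)
    also have "?A * 2 powr (real_of_int j * (\<epsilon> - ?N)) * (2 powr ?N * 2 powr (real_of_int j * ?N) * ?\<omega>)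
       = ?A * 2 powr ?N * ?\<omega> * (2 powr (real_of_int j * (\<epsilon> - ?N)) * 2 powr (real_of_int j * ?N))"
      by simp
    also have "2 powr (real_of_int j * (\<epsilon> - ?N)) * 2 powr (real_of_int j * ?N) = 2 powr (real_of_int j * \<epsilon>)"
      by (simp add: powr_add[symmetric] algebra_simps)
    finally show "(\<integral>\<^sup>+y. ennreal (?A * 2 powr (real_of_int j * (\<epsilon> - ?N))) * ?I j
      * indicator (ball x (2 * 2 powr real_of_int j)) y \<partial>lborel)
      = ennreal (?A * 2 powr ?N * ?\<omega>) * (ennreal (2 powr (real_of_int j * \<epsilon>)) * ?I j)"
      by (simp add: ennreal_mult mult.assoc)
  qed
  also have "\<dots> = ennreal (?A * 2 powr ?N * ?\<omega>) * (\<integral>\<^sup>+j. ennreal (2 powr (real_of_int j * \<epsilon>)) * ?I j \<partial>count_space UNIV)"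
    by (rule nn_integral_cmult) simp
  also have "\<dots> \<le> ennreal (?A * 2 powr ?N * ?\<omega>) * ennreal ((2 * 2 powr real_of_int k) powr \<epsilon> / (1 - 2 powr - \<epsilon>))"
    using \<epsilon> by (intro mult_left_mono dyadic_sum_le) auto
  also have "\<dots> = ennreal (?A * 2 powr ?N * ?\<omega> * ((2 * 2 powr real_of_int k) powr \<epsilon> / (1 - 2 powr - \<epsilon>)))"
    using e1 by (intro ennreal_mult[symmetric]) auto
  also have "?A * 2 powr ?N * ?\<omega> * ((2 * 2 powr real_of_int k) powr \<epsilon> / (1 - 2 powr - \<epsilon>))
      = ?A * 2 powr ?N * ?\<omega> * (2 powr \<epsilon> / (1 - 2 powr - \<epsilon>)) * 2 powr (real_of_int k * \<epsilon>)"
    by (simp add: powr_mult powr_powr)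
  finally show "(\<integral>\<^sup>+y. near_kernel \<epsilon> k x y \<partial>lborel)
      \<le> ennreal (?A * 2 powr ?N * ?\<omega> * (2 powr \<epsilon> / (1 - 2 powr - \<epsilon>)) * 2 powr (real_of_int k * \<epsilon>))" .
qed

lemma ennpowr_wosc:
  fixes u v :: "'a::euclidean_space"
  assumes "0 < p"
  shows "ennpowr (wosc (real DIM('a) / p + s) f G u v) p
     = ennpowr (osc f G u v) p * ennreal (norm (u - v) powr - (real DIM('a) + s * p))"
proof -
  have "- (real DIM('a) / p + s) * p = - (real DIM('a) + s * p)"
    using assms by (simp add: field_simps)
  then show ?thesis
    unfolding wosc_def using assms by (simp add: ennpowr_mult ennpowr_ennreal powr_powr)
qed

text \<open>Jensen's inequality, followed by the volume of the ball of radius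
  \<open>3 * 2^k\<close>. Membership in that ball is relaxed to a condition on \<open>k\<close> for
  fixed \<open>u\<close> and \<open>w\<close>, the shape in which \<open>dyadic_sum_ge\<close> sums
  it.\<close>

lemma ennpowr_oscavg_le:
  fixes f :: "'a::euclidean_space \<Rightarrow> real"
  assumes [measurable]: "f \<in> borel_measurable borel" "G \<in> sets borel" and p: "1 < p"
  shows "ennpowr (oscavg f G k u) p \<le> ennreal (1 / (3 ^ DIM('a) * measure lborel (ball (0::'a) 1)))
    * (\<integral>\<^sup>+w. ennreal (2 powr (- real_of_int k * real DIM('a)))
        * indicator {k. norm (u - w) / 3 \<le> 2 powr real_of_int k} k * ennpowr (osc f G u w) p \<partial>lborel)"
proof -
  let ?r = "3 * 2 powr real_of_int k" and ?\<omega> = "measure lborel (ball (0::'a) 1)"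
  have "emeasure lborel (ball u ?r) = ennreal (?r ^ DIM('a) * ?\<omega>)"
    by (rule emeasure_ball_content) simp
  then have "inverse (emeasure lborel (ball u ?r)) = ennreal (inverse (?r ^ DIM('a) * ?\<omega>))"
    by (simp add: inverse_ennreal)
  also have "inverse (?r ^ DIM('a) * ?\<omega>) = 1 / (3 ^ DIM('a) * ?\<omega>) * 2 powr (- real_of_int k * real DIM('a))"
  proof -
    have "(2 powr real_of_int k) ^ DIM('a) = 2 powr (real_of_int k * real DIM('a))"
      by (rule two_powr_power)
    then show ?thesis by (simp add: power_mult_distrib powr_minus field_simps)
  qed
  also have "ennreal \<dots> = ennreal (1 / (3 ^ DIM('a) * ?\<omega>)) * ennreal (2 powr (- real_of_int k * real DIM('a)))"
    by (intro ennreal_mult) auto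
  finally have inv: "inverse (emeasure lborel (ball u ?r))
    = ennreal (1 / (3 ^ DIM('a) * ?\<omega>)) * ennreal (2 powr (- real_of_int k * real DIM('a)))" .
  have "ennpowr (oscavg f G k u) p \<le> avg (\<lambda>w. ennpowr (osc f G u w) p) u ?r"
    unfolding oscavg_def avg_def using prob_space_unif_ball p by (intro jensen_ennpowr) auto
  also have "\<dots> = inverse (emeasure lborel (ball u ?r)) * (\<integral>\<^sup>+w. ennpowr (osc f G u w) p * indicator (ball u ?r) w \<partial>lborel)"
    by (subst avg_eq) (simp_all add: divide_ennreal_def mult.commute)
  also have "\<dots> = ennreal (1 / (3 ^ DIM('a) * ?\<omega>)) * (\<integral>\<^sup>+w. ennreal (2 powr (- real_of_int k * real DIM('a))) *
      (ennpowr (osc f G u w) p * indicator (ball u ?r) w) \<partial>lborel)"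
    unfolding inv mult.assoc
    by (subst nn_integral_cmult) (auto intro!: borel_measurable_times_ennreal borel_measurable_indicator)
  also have "\<dots> \<le> ennreal (1 / (3 ^ DIM('a) * ?\<omega>)) * (\<integral>\<^sup>+w. ennreal (2 powr (- real_of_int k * real DIM('a)))
        * indicator {k. norm (u - w) / 3 \<le> 2 powr real_of_int k} k * ennpowr (osc f G u w) p \<partial>lborel)"
    by (intro mult_left_mono nn_integral_mono) (auto simp: indicator_def dist_norm)
  finally show ?thesis .
qed

text \<open>After the sum is moved inside the integrals, each pair \<open>u \<noteq> w\<close>
  carries a geometric series in \<open>k\<close> with exponent \<open>n + s p\<close>, starting
  where \<open>2^k\<close> reaches \<open>|u - w| / 3\<close>. Its value is a multiple of the kernel
  in \<open>wosc\<close> to the power \<open>p\<close>.\<close>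

lemma sum_oscavg:
  assumes p: "1 < p"
  obtains C :: real where "0 < C"
    "\<And>s (f :: 'a::euclidean_space \<Rightarrow> real) G. 0 < s \<Longrightarrow> s < 1 \<Longrightarrow> f \<in> borel_measurable borel \<Longrightarrow> G \<in> sets borel \<Longrightarrow>
      (\<integral>\<^sup>+k. ennreal (2 powr (- real_of_int k * (s * p))) * (\<integral>\<^sup>+u. ennpowr (oscavg f G k u) p \<partial>lborel) \<partial>count_space UNIV)
       \<le> ennreal C * (\<integral>\<^sup>+u. (\<integral>\<^sup>+v. ennpowr (wosc (real DIM('a) / p + s) f G u v) p \<partial>lborel) \<partial>lborel)"
proof
  let ?N = "real DIM('a)"
  let ?c = "1 / (3 ^ DIM('a) * measure lborel (ball (0::'a) 1))" and ?d = "2 * 3 powr (?N + p)"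
  have c: "0 < ?c" by simp
  then show "0 < ?c * ?d" by (intro mult_pos_pos) auto
  fix s :: real and f :: "'a \<Rightarrow> real" and G :: "'a set"
  assume s: "0 < s" "s < 1" and [measurable]: "f \<in> borel_measurable borel" "G \<in> sets borel"
  have N: "1 \<le> ?N" using DIM_ge_Suc0[where 'a='a] by simp
  have sp: "s * p < p" "0 < s * p" using s p by auto
  let ?O = "\<lambda>u w. ennpowr (osc f G u w) p" and ?q = "?N + s * p"
  let ?I = "\<lambda>u w k. indicator {k. norm (u - w) / 3 \<le> 2 powr real_of_int k} (k::int) :: ennreal"
  have I [measurable]: "(\<lambda>(u, w). ?I u w k) \<in> borel_measurable (borel \<Otimes>\<^sub>M (borel :: 'a measure))" for k
  proof -
    have "(\<lambda>(u, w::'a). ?I u w k) = indicator {z. norm (fst z - snd z) / 3 \<le> 2 powr real_of_int k}"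
      by (auto simp: indicator_def fun_eq_iff)
    also have "\<dots> \<in> borel_measurable (borel \<Otimes>\<^sub>M borel)"
      unfolding borel_prod
      by (intro borel_measurable_indicator borel_closed closed_Collect_le continuous_intros) auto
    finally show ?thesis .
  qed
  have q: "ennreal (2 powr (- real_of_int k * (s * p))) * ennreal (2 powr (- real_of_int k * ?N))
     = ennreal (2 powr (- real_of_int k * ?q))" for k
    by (simp add: ennreal_mult[symmetric] powr_add[symmetric] algebra_simps)
  have pt: "(\<integral>\<^sup>+k. ennreal (2 powr (- real_of_int k * ?q)) * ?I u w k * ?O u w \<partial>count_space UNIV)
      \<le> ennreal ?d * ennpowr (wosc (?N / p + s) f G u w) p" for u w
  proof (cases "u = w")
    case False
    let ?n = "norm (u - w)"
    \<comment> \<open>Because the dimension is at least 1, the ratio of the series is at most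
      \<open>1/2\<close> for every \<open>s > 0\<close>. This is the factor \<open>2\<close> in
      \<open>?d\<close>, and no \<open>s\<close> enters the constant.\<close>
    have "- ?q \<le> - 1" using N sp by linarith
    then have "2 powr - ?q \<le> (2 powr - 1 :: real)" by (intro powr_mono) auto
    then have h: "1 / 2 \<le> 1 - 2 powr - ?q" by (simp add: powr_minus)
    have "(\<integral>\<^sup>+k. ennreal (2 powr (- real_of_int k * ?q)) * ?I u w k * ?O u w \<partial>count_space UNIV)
        = (\<integral>\<^sup>+k. ennreal (2 powr (- real_of_int k * ?q)) * ?I u w k \<partial>count_space UNIV) * ?O u w"
      by (rule nn_integral_multc) simp
    also have "\<dots> \<le> ennreal ((?n / 3) powr - ?q / (1 - 2 powr - ?q)) * ?O u w"
      using False N sp by (intro mult_right_mono dyadic_sum_ge) auto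
    also have "\<dots> \<le> ennreal (?d * ?n powr - ?q) * ?O u w"
    proof (intro mult_right_mono ennreal_leI)
      have "(?n / 3) powr - ?q / (1 - 2 powr - ?q) \<le> (?n / 3) powr - ?q / (1 / 2)"
        using h by (intro divide_left_mono) auto
      also have "\<dots> = 2 * 3 powr ?q * ?n powr - ?q"
        by (simp only: powr_divide powr_minus) (simp add: field_simps)
      also have "\<dots> \<le> ?d * ?n powr - ?q"
      proof (intro mult_right_mono mult_left_mono powr_mono)
        show "?q \<le> ?N + p" using sp by linarith
      qed auto
      finally show "(?n / 3) powr - ?q / (1 - 2 powr - ?q) \<le> ?d * ?n powr - ?q" .
    qed simp
    also have "\<dots> = ennreal ?d * ennpowr (wosc (?N / p + s) f G u w) p"
      using p by (subst ennpowr_wosc) (auto simp: ennreal_mult mult_ac)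
    finally show ?thesis .
  qed (simp add: osc_def)
  have "(\<integral>\<^sup>+k. ennreal (2 powr (- real_of_int k * (s * p))) * (\<integral>\<^sup>+u. ennpowr (oscavg f G k u) p \<partial>lborel) \<partial>count_space UNIV)
    \<le> (\<integral>\<^sup>+k. ennreal (2 powr (- real_of_int k * (s * p))) * (\<integral>\<^sup>+u. ennreal ?c
      * (\<integral>\<^sup>+w. ennreal (2 powr (- real_of_int k * ?N)) * ?I u w k * ?O u w \<partial>lborel) \<partial>lborel) \<partial>count_space UNIV)"
    using p by (intro nn_integral_mono mult_left_mono ennpowr_oscavg_le) auto
  also have "\<dots> = (\<integral>\<^sup>+k. ennreal ?c * (\<integral>\<^sup>+u. (\<integral>\<^sup>+w. ennreal (2 powr (- real_of_int k * ?q)) * ?I u w k * ?O u w \<partial>lborel) \<partial>lborel) \<partial>count_space UNIV)"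
  proof (intro nn_integral_cong)
    fix k :: int
    have "ennreal (2 powr (- real_of_int k * (s * p))) * (\<integral>\<^sup>+u. ennreal ?c
      * (\<integral>\<^sup>+w. ennreal (2 powr (- real_of_int k * ?N)) * ?I u w k * ?O u w \<partial>lborel) \<partial>lborel)
      = ennreal (2 powr (- real_of_int k * (s * p))) * (ennreal ?c * (ennreal (2 powr (- real_of_int k * ?N))
        * (\<integral>\<^sup>+u. (\<integral>\<^sup>+w. ?I u w k * ?O u w \<partial>lborel) \<partial>lborel)))"
    proof -
      have "(\<integral>\<^sup>+w. ennreal (2 powr (- real_of_int k * ?N)) * (?I u w k * ?O u w) \<partial>lborel)
          = ennreal (2 powr (- real_of_int k * ?N)) * (\<integral>\<^sup>+w. ?I u w k * ?O u w \<partial>lborel)" for u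
        by (rule nn_integral_cmult) measurable
      then show ?thesis
        unfolding mult.assoc by (simp add: nn_integral_cmult)
    qed
    also have "\<dots> = ennreal ?c * (ennreal (2 powr (- real_of_int k * ?q))
        * (\<integral>\<^sup>+u. (\<integral>\<^sup>+w. ?I u w k * ?O u w \<partial>lborel) \<partial>lborel))"
      unfolding q[symmetric] by (simp only: mult_ac)
    also have "\<dots> = ennreal ?c * (\<integral>\<^sup>+u. (\<integral>\<^sup>+w. ennreal (2 powr (- real_of_int k * ?q)) * ?I u w k * ?O u w \<partial>lborel) \<partial>lborel)"
      unfolding mult.assoc by (subst nn_integral_cmult2) measurable
    finally show "ennreal (2 powr (- real_of_int k * (s * p))) * (\<integral>\<^sup>+u. ennreal ?c
      * (\<integral>\<^sup>+w. ennreal (2 powr (- real_of_int k * ?N)) * ?I u w k * ?O u w \<partial>lborel) \<partial>lborel)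
      = ennreal ?c * (\<integral>\<^sup>+u. (\<integral>\<^sup>+w. ennreal (2 powr (- real_of_int k * ?q)) * ?I u w k * ?O u w \<partial>lborel) \<partial>lborel)" .
  qed
  also have "\<dots> = ennreal ?c * (\<integral>\<^sup>+k. (\<integral>\<^sup>+u. (\<integral>\<^sup>+w. ennreal (2 powr (- real_of_int k * ?q)) * ?I u w k * ?O u w \<partial>lborel) \<partial>lborel) \<partial>count_space UNIV)"
    by (rule nn_integral_cmult) simp
  also have "\<dots> = ennreal ?c * (\<integral>\<^sup>+u. (\<integral>\<^sup>+w. (\<integral>\<^sup>+k. ennreal (2 powr (- real_of_int k * ?q)) * ?I u w k * ?O u w \<partial>count_space UNIV) \<partial>lborel) \<partial>lborel)"
    by (intro arg_cong[where f = "(*) (ennreal ?c)"] nn_integral_swap_int2) measurable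
  also have "\<dots> \<le> ennreal ?c * (\<integral>\<^sup>+u. (\<integral>\<^sup>+w. ennreal ?d * ennpowr (wosc (?N / p + s) f G u w) p \<partial>lborel) \<partial>lborel)"
    by (intro mult_left_mono nn_integral_mono pt) auto
  also have "\<dots> = ennreal (?c * ?d) * (\<integral>\<^sup>+u. (\<integral>\<^sup>+v. ennpowr (wosc (?N / p + s) f G u v) p \<partial>lborel) \<partial>lborel)"
  proof -
    have "ennreal (?c * ?d) = ennreal ?c * ennreal ?d"
      by (rule ennreal_mult) auto
    then show ?thesis
      by (simp only: mult.assoc) (subst nn_integral_cmult2, measurable)
  qed
  finally show "(\<integral>\<^sup>+k. ennreal (2 powr (- real_of_int k * (s * p))) * (\<integral>\<^sup>+u. ennpowr (oscavg f G k u) p \<partial>lborel) \<partial>count_space UNIV)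
       \<le> ennreal (?c * ?d) * (\<integral>\<^sup>+u. (\<integral>\<^sup>+v. ennpowr (wosc (?N / p + s) f G u v) p \<partial>lborel) \<partial>lborel)" .
qed

lemma majorant_measurable [measurable]:
  fixes f :: "'a::euclidean_space \<Rightarrow> real"
  assumes [measurable]: "f \<in> borel_measurable borel" "G \<in> sets borel"
  shows "(\<lambda>(x, y). majorant p \<epsilon> s f G x y) \<in> borel_measurable (borel \<Otimes>\<^sub>M borel)"
  unfolding majorant_def by measurable

text \<open>The first summand is handled by \<open>smax_strong\<close>. In the second, integrating
  \<open>near_kernel\<close> in the variable absent from the maximal function gives
  \<open>2^(k \<epsilon>)\<close>, leaving \<open>2^(-k s p)\<close>; then
  \<open>hlmax_strong\<close> removes the maximal function and \<open>sum_oscavg\<close> performs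
  the sum over \<open>k\<close>.\<close>

lemma majorant_integral:
  assumes p: "1 < p" and \<epsilon>: "0 < \<epsilon>" "\<epsilon> < 1"
  obtains C :: real where "0 < C"
    "\<And>s (f :: 'a::euclidean_space \<Rightarrow> real) G. 0 < s \<Longrightarrow> s < 1 \<Longrightarrow> f \<in> borel_measurable borel \<Longrightarrow> G \<in> sets borel \<Longrightarrow>
      (\<integral>\<^sup>+x. (\<integral>\<^sup>+y. majorant p \<epsilon> s f G x y \<partial>lborel) \<partial>lborel)
       \<le> ennreal C * (\<integral>\<^sup>+x. (\<integral>\<^sup>+y. ennpowr (wosc (real DIM('a) / p + s) f G x y) p \<partial>lborel) \<partial>lborel)"
proof -
  let ?N = "real DIM('a)"
  obtain S :: real where S: "0 < S"
    "\<And>F :: 'a \<Rightarrow> 'a \<Rightarrow> ennreal. (\<lambda>(x, y). F x y) \<in> borel_measurable (borel \<Otimes>\<^sub>M borel) \<Longrightarrow>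
      (\<integral>\<^sup>+x. (\<integral>\<^sup>+y. ennpowr (smax F x y) p \<partial>lborel) \<partial>lborel)
        \<le> ennreal S * (\<integral>\<^sup>+x. (\<integral>\<^sup>+y. ennpowr (F x y) p \<partial>lborel) \<partial>lborel)"
    by (rule smax_strong[OF p]) blast
  obtain H :: real where H: "0 < H"
    "\<And>g :: 'a \<Rightarrow> ennreal. g \<in> borel_measurable borel \<Longrightarrow>
      (\<integral>\<^sup>+x. ennpowr (hlmax g x) p \<partial>lborel) \<le> ennreal H * (\<integral>\<^sup>+x. ennpowr (g x) p \<partial>lborel)"
    by (rule hlmax_strong[OF p]) blast
  obtain E :: real where E: "0 < E"
    "\<And>k (x::'a). (\<integral>\<^sup>+y. near_kernel \<epsilon> k x y \<partial>lborel) \<le> ennreal (E * 2 powr (real_of_int k * \<epsilon>))"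
    by (rule near_kernel_integral[OF \<epsilon>]) blast
  obtain D :: real where D: "0 < D"
    "\<And>s (f :: 'a \<Rightarrow> real) G. 0 < s \<Longrightarrow> s < 1 \<Longrightarrow> f \<in> borel_measurable borel \<Longrightarrow> G \<in> sets borel \<Longrightarrow>
      (\<integral>\<^sup>+k. ennreal (2 powr (- real_of_int k * (s * p))) * (\<integral>\<^sup>+u. ennpowr (oscavg f G k u) p \<partial>lborel) \<partial>count_space UNIV)
       \<le> ennreal D * (\<integral>\<^sup>+u. (\<integral>\<^sup>+v. ennpowr (wosc (?N / p + s) f G u v) p \<partial>lborel) \<partial>lborel)"
    by (rule sum_oscavg[OF p]) blast
  show thesis
  proof (rule that[of "S + 2 * E * H * D"])
    show "0 < S + 2 * E * H * D" using S E H D by (intro add_pos_pos mult_pos_pos) auto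
    fix s :: real and f :: "'a \<Rightarrow> real" and G :: "'a set"
    assume s: "0 < s" "s < 1" and [measurable]: "f \<in> borel_measurable borel" "G \<in> sets borel"
    let ?W = "\<integral>\<^sup>+x. (\<integral>\<^sup>+y. ennpowr (wosc (?N / p + s) f G x y) p \<partial>lborel) \<partial>lborel"
    let ?J = "\<lambda>k x. ennpowr (hlmax (oscavg f G k) x) p"
    let ?e = "\<lambda>k. ennreal (2 powr (- real_of_int k * (\<epsilon> + s * p)))"
    let ?B = "\<lambda>k x y. ?e k * near_kernel \<epsilon> k x y * (?J k x + ?J k y)"
    have Bint: "(\<integral>\<^sup>+x. (\<integral>\<^sup>+y. ?B k x y \<partial>lborel) \<partial>lborel)
        \<le> ennreal (2 * E * H) * (ennreal (2 powr (- real_of_int k * (s * p))) * (\<integral>\<^sup>+u. ennpowr (oscavg f G k u) p \<partial>lborel))" for k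
    proof -
      let ?K = "near_kernel \<epsilon> k :: 'a \<Rightarrow> 'a \<Rightarrow> ennreal"
      let ?T = "ennreal (E * 2 powr (real_of_int k * \<epsilon>)) * (\<integral>\<^sup>+x. ?J k x \<partial>lborel)"
      have "(\<integral>\<^sup>+x. (\<integral>\<^sup>+y. ?K x y * ?J k x \<partial>lborel) \<partial>lborel) = (\<integral>\<^sup>+x. (\<integral>\<^sup>+y. ?K x y \<partial>lborel) * ?J k x \<partial>lborel)"
        by (intro nn_integral_cong nn_integral_multc) measurable
      also have "\<dots> \<le> (\<integral>\<^sup>+x. ennreal (E * 2 powr (real_of_int k * \<epsilon>)) * ?J k x \<partial>lborel)"
        by (intro nn_integral_mono mult_right_mono E) auto
      also have "\<dots> = ?T"
        by (rule nn_integral_cmult) measurable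
      finally have X: "(\<integral>\<^sup>+x. (\<integral>\<^sup>+y. ?K x y * ?J k x \<partial>lborel) \<partial>lborel) \<le> ?T" .
      \<comment> \<open>The kernel is symmetric, so exchanging the integrals reduces the term with
        \<open>?J k y\<close> to the previous one.\<close>
      have "(\<integral>\<^sup>+x. (\<integral>\<^sup>+y. ?K x y * ?J k y \<partial>lborel) \<partial>lborel) = (\<integral>\<^sup>+y. (\<integral>\<^sup>+x. ?K x y * ?J k y \<partial>lborel) \<partial>lborel)"
        by (rule lborel_pair.Fubini') measurable
      also have "\<dots> = (\<integral>\<^sup>+x. (\<integral>\<^sup>+y. ?K x y * ?J k x \<partial>lborel) \<partial>lborel)"
        by (simp only: near_kernel_commute)
      finally have Y: "(\<integral>\<^sup>+x. (\<integral>\<^sup>+y. ?K x y * ?J k y \<partial>lborel) \<partial>lborel) \<le> ?T" using X by simp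
      have "(\<integral>\<^sup>+x. (\<integral>\<^sup>+y. ?B k x y \<partial>lborel) \<partial>lborel)
          = ?e k * (\<integral>\<^sup>+x. (\<integral>\<^sup>+y. ?K x y * (?J k x + ?J k y) \<partial>lborel) \<partial>lborel)"
        unfolding mult.assoc by (rule nn_integral_cmult2) measurable
      also have "(\<integral>\<^sup>+x. (\<integral>\<^sup>+y. ?K x y * (?J k x + ?J k y) \<partial>lborel) \<partial>lborel)
          = (\<integral>\<^sup>+x. (\<integral>\<^sup>+y. ?K x y * ?J k x \<partial>lborel) \<partial>lborel) + (\<integral>\<^sup>+x. (\<integral>\<^sup>+y. ?K x y * ?J k y \<partial>lborel) \<partial>lborel)"
        unfolding distrib_left by (rule nn_integral_add2) measurable
      also have "?e k * \<dots> \<le> ?e k * (?T + ?T)"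
        by (intro mult_left_mono add_mono X Y) auto
      also have "\<dots> = ennreal (2 * E) * ennreal (2 powr (- real_of_int k * (s * p))) * (\<integral>\<^sup>+x. ?J k x \<partial>lborel)"
      proof -
        have "2 powr (- real_of_int k * (\<epsilon> + s * p)) * (2 * (E * 2 powr (real_of_int k * \<epsilon>)))
            = 2 * E * 2 powr (- real_of_int k * (s * p))"
          by (simp add: powr_add[symmetric] algebra_simps)
        then have "?e k * (2 * ennreal (E * 2 powr (real_of_int k * \<epsilon>))) = ennreal (2 * E) * ennreal (2 powr (- real_of_int k * (s * p)))"
          using E by (simp add: ennreal_mult[symmetric] numeral_mult_ennreal)
        then show ?thesis by (simp only: mult_2[symmetric] mult.assoc[symmetric])
      qed
      also have "\<dots> \<le> ennreal (2 * E) * ennreal (2 powr (- real_of_int k * (s * p))) * (ennreal H * (\<integral>\<^sup>+x. ennpowr (oscavg f G k x) p \<partial>lborel))"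
        by (intro mult_left_mono H) auto
      also have "\<dots> = ennreal (2 * E * H) * (ennreal (2 powr (- real_of_int k * (s * p))) * (\<integral>\<^sup>+u. ennpowr (oscavg f G k u) p \<partial>lborel))"
        using E H by (simp add: ennreal_mult mult_ac)
      finally show ?thesis .
    qed
    have "(\<integral>\<^sup>+x. (\<integral>\<^sup>+y. majorant p \<epsilon> s f G x y \<partial>lborel) \<partial>lborel)
        = (\<integral>\<^sup>+x. (\<integral>\<^sup>+y. ennpowr (smax (wosc (?N / p + s) f G) x y) p \<partial>lborel) \<partial>lborel)
          + (\<integral>\<^sup>+x. (\<integral>\<^sup>+y. (\<integral>\<^sup>+k. ?B k x y \<partial>count_space UNIV) \<partial>lborel) \<partial>lborel)"
      unfolding majorant_def by (rule nn_integral_add2) measurable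
    also have "\<dots> \<le> ennreal S * ?W + ennreal (2 * E * H * D) * ?W"
    proof (rule add_mono)
      show "(\<integral>\<^sup>+x. (\<integral>\<^sup>+y. ennpowr (smax (wosc (?N / p + s) f G) x y) p \<partial>lborel) \<partial>lborel) \<le> ennreal S * ?W"
        by (intro S) measurable
      have "(\<integral>\<^sup>+x. (\<integral>\<^sup>+y. (\<integral>\<^sup>+k. ?B k x y \<partial>count_space UNIV) \<partial>lborel) \<partial>lborel)
          = (\<integral>\<^sup>+k. (\<integral>\<^sup>+x. (\<integral>\<^sup>+y. ?B k x y \<partial>lborel) \<partial>lborel) \<partial>count_space UNIV)"
        by (rule nn_integral_swap_int2[symmetric]) measurable
      also have "\<dots> \<le> (\<integral>\<^sup>+k. ennreal (2 * E * H) * (ennreal (2 powr (- real_of_int k * (s * p))) * (\<integral>\<^sup>+u. ennpowr (oscavg f G k u) p \<partial>lborel)) \<partial>count_space UNIV)"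
        by (intro nn_integral_mono Bint)
      also have "\<dots> = ennreal (2 * E * H) * (\<integral>\<^sup>+k. ennreal (2 powr (- real_of_int k * (s * p))) * (\<integral>\<^sup>+u. ennpowr (oscavg f G k u) p \<partial>lborel) \<partial>count_space UNIV)"
        by (rule nn_integral_cmult) simp
      also have "\<dots> \<le> ennreal (2 * E * H) * (ennreal D * ?W)"
        using s by (intro mult_left_mono D) auto
      also have "\<dots> = ennreal (2 * E * H * D) * ?W"
        using E H D by (simp add: ennreal_mult mult_ac)
      finally show "(\<integral>\<^sup>+x. (\<integral>\<^sup>+y. (\<integral>\<^sup>+k. ?B k x y \<partial>count_space UNIV) \<partial>lborel) \<partial>lborel) \<le> ennreal (2 * E * H * D) * ?W" .
    qed
    also have "\<dots> = ennreal (S + 2 * E * H * D) * ?W"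
      using S E H D by (simp add: distrib_right[symmetric])
    finally show "(\<integral>\<^sup>+x. (\<integral>\<^sup>+y. majorant p \<epsilon> s f G x y \<partial>lborel) \<partial>lborel) \<le> ennreal (S + 2 * E * H * D) * ?W" .
  qed
qed

subsection \<open>The maximal operator on an open set\<close>

lemma nn_integral_lebesgue_on:
  fixes f :: "'a::euclidean_space \<Rightarrow> ennreal"
  assumes "S \<in> sets borel"
  shows "(\<integral>\<^sup>+x. f x \<partial>lebesgue_on S) = (\<integral>\<^sup>+x. f x * indicator S x \<partial>lborel)"
  using assms by (subst nn_integral_restrict_space) (auto simp: nn_integral_completion)

text \<open>Agreement almost everywhere suffices for positive radii, but radius 0 evaluates the
  function at \<open>x\<close>, so equality at that point is required separately.\<close>

lemma ball_average_eq_avg: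
  fixes f g :: "real ^ 'n \<Rightarrow> real"
  assumes g [measurable]: "g \<in> borel_measurable borel" and ae: "AE y in lborel. y \<in> G \<longrightarrow> f y = g y"
    and x: "f x = g x" and r: "0 \<le> r" "ball x r \<subseteq> G"
  shows "ball_average f x r = avg (\<lambda>u. ennreal \<bar>g u\<bar>) x r"
proof (cases "r = 0")
  case False
  have "(\<integral>\<^sup>+y. ennreal \<bar>f y\<bar> \<partial>lebesgue_on (ball x r)) = (\<integral>\<^sup>+y. ennreal \<bar>f y\<bar> * indicator (ball x r) y \<partial>lborel)"
    by (rule nn_integral_lebesgue_on) simp
  also have "\<dots> = (\<integral>\<^sup>+y. ennreal \<bar>g y\<bar> * indicator (ball x r) y \<partial>lborel)"
    using ae r by (intro nn_integral_cong_AE) (auto elim!: eventually_mono simp: indicator_def)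
  finally show ?thesis
    using False r by (subst avg_eq) (simp_all add: ball_average_def)
qed (simp add: ball_average_def x)

text \<open>A ball that meets \<open>G\<close> without being contained in it is connected, so it
  contains a frontier point of \<open>G\<close>, at distance less than \<open>r\<close> from
  \<open>x\<close>.\<close>

lemma ball_subset_boundary_dist:
  fixes x :: "real ^ 'n"
  assumes "x \<in> G" "ereal r \<le> boundary_dist G x"
  shows "ball x r \<subseteq> G"
proof (rule ccontr)
  assume neg: "\<not> ball x r \<subseteq> G"
  then have "ball x r \<noteq> {}" "G \<noteq> UNIV" by blast+
  then have "0 < r" "G \<noteq> UNIV" by (simp_all add: ball_eq_empty not_le)
  then have r: "r \<le> infdist x (frontier G)" using assms by (simp add: boundary_dist_def)
  have "ball x r \<inter> frontier G \<noteq> {}"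
  proof (rule connected_Int_frontier)
    show "ball x r \<inter> G \<noteq> {}" using assms(1) \<open>0 < r\<close> centre_in_ball by blast
  qed (use neg in auto)
  then obtain y where "y \<in> frontier G" "dist x y < r" by auto
  with infdist_le[of y "frontier G" x] r show False by simp
qed

text \<open>Finiteness is essential: \<open>absdiff top top\<close> is \<open>top\<close>, while
  both additive bounds hold there with zero error. This is why \<open>max_op_finite\<close> must
  precede the final estimate.\<close>

lemma absdiff_le:
  assumes "a \<noteq> top" "b \<noteq> top" "a \<le> b + k" "b \<le> a + l"
  shows "absdiff a b \<le> max k l"
proof (cases a; cases b; cases "k = top \<or> l = top")
  fix \<alpha> \<beta> assume a: "a = ennreal \<alpha>" "0 \<le> \<alpha>" and b: "b = ennreal \<beta>" "0 \<le> \<beta>"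
    and kl: "\<not> (k = top \<or> l = top)"
  obtain \<kappa> \<mu> where k: "k = ennreal \<kappa>" "0 \<le> \<kappa>" "l = ennreal \<mu>" "0 \<le> \<mu>"
    using kl by (cases k; cases l) auto
  have "\<alpha> \<le> \<beta> + \<kappa>" "\<beta> \<le> \<alpha> + \<mu>"
    using assms(3,4) a b k by (auto simp: ennreal_plus[symmetric] simp del: ennreal_plus)
  then have "ennreal \<bar>\<alpha> - \<beta>\<bar> \<le> ennreal (max \<kappa> \<mu>)"
    by (intro ennreal_leI) linarith
  then show ?thesis
    using a b k by (simp add: absdiff_def max_def ennreal_le_iff split: if_splits)
qed (use assms in \<open>auto simp: max_def top_unique\<close>)

text \<open>Taking the root turns the bound on the weighted power of \<open>c\<close> into an
  additive error that does not mention \<open>c\<close>, so that the supremum over radii can be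
  formed before any p-th power.\<close>

lemma le_ennpowr_root:
  assumes "0 < p" "0 < w" "ennpowr c p * ennreal w \<le> A"
  shows "c \<le> ennpowr (A * ennreal (1 / w)) (1 / p)"
proof -
  have "ennpowr c p = ennpowr c p * ennreal w * ennreal (1 / w)"
    using assms by (simp add: mult.assoc ennreal_mult[symmetric])
  also have "\<dots> \<le> A * ennreal (1 / w)"
    using assms by (intro mult_right_mono) auto
  finally have "ennpowr (ennpowr c p) (1 / p) \<le> ennpowr (A * ennreal (1 / w)) (1 / p)"
    using assms by (intro ennpowr_mono) auto
  then show ?thesis using assms by (simp add: ennpowr_ennpowr)
qed

lemma absdiff_ennpowr_le:
  assumes "0 < p" "0 < w" "a \<noteq> top" "b \<noteq> top"
    and "a \<le> b + ennpowr (A * ennreal (1 / w)) (1 / p)" "b \<le> a + ennpowr (B * ennreal (1 / w)) (1 / p)"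
  shows "ennpowr (absdiff a b) p * ennreal w \<le> A + B"
proof -
  have "ennpowr (absdiff a b) p \<le> ennpowr (max (ennpowr (A * ennreal (1 / w)) (1 / p)) (ennpowr (B * ennreal (1 / w)) (1 / p))) p"
    using assms by (intro ennpowr_mono absdiff_le) auto
  also have "\<dots> \<le> A * ennreal (1 / w) + B * ennreal (1 / w)"
    using assms ennpowr_max_le[of p "ennpowr (A * ennreal (1 / w)) (1 / p)" "ennpowr (B * ennreal (1 / w)) (1 / p)"]
    by (simp add: ennpowr_ennpowr)
  finally have "ennpowr (absdiff a b) p * ennreal w \<le> (A * ennreal (1 / w) + B * ennreal (1 / w)) * ennreal w"
    by (rule mult_right_mono) simp
  also have "\<dots> = A + B"
    using assms by (simp add: distrib_right mult.assoc ennreal_mult[symmetric])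
  finally show ?thesis .
qed

lemma divide_ennreal_inverse: "0 < a \<Longrightarrow> X / ennreal a = X * ennreal (1 / a)"
  by (simp add: divide_ennreal_def inverse_ennreal divide_inverse)

text \<open>\<open>f\<close> is only Lebesgue measurable; \<open>g\<close> is a Borel representative
  on \<open>G\<close>, and all auxiliary maximal functions are built from \<open>g\<close>. Because
  radius 0 always competes in \<open>max_op\<close>, the estimates are stated at points with
  \<open>f x = g x\<close>.\<close>

locale radius_function =
  fixes G :: "(real ^ 'n) set" and R :: "real ^ 'n \<Rightarrow> real" and f g :: "real ^ 'n \<Rightarrow> real"
  assumes G_open: "open G"
    and R: "\<And>x. x \<in> G \<Longrightarrow> 0 \<le> R x \<and> ereal (R x) \<le> boundary_dist G x"
    and g [measurable]: "g \<in> borel_measurable borel"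
    and ae: "AE y in lborel. y \<in> G \<longrightarrow> f y = g y"
begin

lemma G_borel [measurable]: "G \<in> sets borel"
  using G_open by simp

lemma in_G:
  assumes "x \<in> G" "0 \<le> r" "r \<le> R x" "norm z < 1"
  shows "x + r *\<^sub>R z \<in> G"
proof (cases "r = 0")
  case False
  have "norm (r *\<^sub>R z) < r" using assms False by simp
  then have "x + r *\<^sub>R z \<in> ball x (R x)" using assms by (simp add: dist_norm)
  then show ?thesis using ball_subset_boundary_dist[of x G "R x"] R[of x] assms by blast
qed (use assms in simp)

lemma ball_average_avg:
  assumes "x \<in> G" "f x = g x" "0 \<le> r" "r \<le> R x"
  shows "ball_average f x r = avg (\<lambda>u. ennreal \<bar>g u\<bar>) x r"
proof (rule ball_average_eq_avg[OF g ae])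
  have "ball x r \<subseteq> ball x (R x)" using assms by (intro subset_ball)
  then show "ball x r \<subseteq> G" using ball_subset_boundary_dist[of x G "R x"] R[of x] assms by blast
qed (use assms in auto)

lemma max_op_le_hlmax:
  assumes "x \<in> G" "f x = g x"
  shows "max_op R f x \<le> ennreal (2 ^ CARD('n)) * hlmax (\<lambda>u. ennreal \<bar>g u\<bar> * indicator G u) x"
  unfolding max_op_def
proof (rule SUP_least)
  fix r assume r: "r \<in> {0..R x}"
  have "ball_average f x r = avg (\<lambda>u. ennreal \<bar>g u\<bar>) x r"
    using r assms by (intro ball_average_avg) auto
  also have "\<dots> \<le> avg (\<lambda>u. ennreal \<bar>g u\<bar> * indicator G u) x r"
    using r assms by (intro avg_mono_ball) (auto simp: in_G)
  also have "\<dots> \<le> ennreal (2 ^ DIM(real ^ 'n)) * hlmax (\<lambda>u. ennreal \<bar>g u\<bar> * indicator G u) x"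
    using r by (intro avg_le_hlmax) auto
  finally show "ball_average f x r \<le> ennreal (2 ^ CARD('n)) * hlmax (\<lambda>u. ennreal \<bar>g u\<bar> * indicator G u) x"
    by simp
qed

lemma max_op_le_add:
  assumes p: "1 < p" and \<epsilon>: "0 < \<epsilon>" "\<epsilon> < 1" and s: "0 < s" "s < 1"
    and x: "x \<in> G" "f x = g x" and y: "y \<in> G" "f y = g y" and xy: "x \<noteq> y"
  defines "w \<equiv> (norm (x - y) + \<bar>R x - R y\<bar>) powr - (\<epsilon> + s * p) * norm (x - y) powr (\<epsilon> - real CARD('n))"
    and "K \<equiv> 5 powr (real CARD('n) + p) * 24 powr (real CARD('n) * p) * 2 powr (1 + 2 * p)"
  shows "max_op R f x \<le> max_op R f y + ennpowr (ennreal K * majorant p \<epsilon> s g G x y * ennreal (1 / w)) (1 / p)"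
  unfolding max_op_def[of R f x]
proof (rule SUP_least)
  fix r assume r: "r \<in> {0..R x}"
  define q where "q = min r (R y)"
  define \<delta> where "\<delta> = norm (x - y) + \<bar>R x - R y\<bar>"
  have Ry: "0 \<le> R y" using R y by blast
  have q: "0 \<le> q" "q \<le> r" "q \<le> R y" using r Ry by (auto simp: q_def)
  \<comment> \<open>The gap \<open>r - q\<close> is positive only if \<open>r > R y\<close>; then
    \<open>r \<le> R x\<close> bounds it by \<open>R x - R y\<close>.\<close>
  have \<delta>: "norm (x - y) \<le> \<delta>" "r - q \<le> \<delta>" using r norm_ge_zero[of "x - y"] by (auto simp: q_def \<delta>_def min_def simp del: norm_ge_zero)
  have "0 < \<delta>" using xy \<delta>(1) by (simp add: less_le_trans[of 0 "norm (x - y)"])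
  then have w: "0 < w" using xy by (simp add: w_def \<delta>_def)
  obtain c where c: "avg (\<lambda>u. ennreal \<bar>g u\<bar>) x r \<le> avg (\<lambda>u. ennreal \<bar>g u\<bar>) y q + c"
    "ennpowr c p * ennreal w \<le> ennreal K * majorant p \<epsilon> s g G x y"
  proof (rule pointwise_bound[OF p \<epsilon> s g G_borel _ _ q(1,2) \<delta> xy])
    show "x + r *\<^sub>R z \<in> G" if "norm z < 1" for z
      using in_G[of x r z] x r that by simp
    show "y + q *\<^sub>R z \<in> G" if "norm z < 1" for z
      using in_G[of y q z] y q that by simp
  qed (simp add: w_def K_def \<delta>_def)
  have "ball_average f x r \<le> ball_average f y q + c"
    using c(1) x y r q by (simp add: ball_average_avg)
  also have "\<dots> \<le> max_op R f y + ennpowr (ennreal K * majorant p \<epsilon> s g G x y * ennreal (1 / w)) (1 / p)"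
    using c(2) w p q unfolding max_op_def by (intro add_mono le_ennpowr_root SUP_upper) auto
  finally show "ball_average f x r \<le> max_op R f y + ennpowr (ennreal K * majorant p \<epsilon> s g G x y * ennreal (1 / w)) (1 / p)" .
qed

text \<open>The weight is symmetric in \<open>x\<close> and \<open>y\<close>, while the one-sided
  bound is not; it is used in both directions, whence the two values of
  \<open>majorant\<close>.\<close>

lemma energy_le_majorant:
  assumes p: "1 < p" and \<epsilon>: "0 < \<epsilon>" "\<epsilon> < 1" and s: "0 < s" "s < 1"
    and x: "x \<in> G" "f x = g x" "max_op R f x \<noteq> top" and y: "y \<in> G" "f y = g y" "max_op R f y \<noteq> top"
    and xy: "x \<noteq> y"
  defines "K \<equiv> 5 powr (real CARD('n) + p) * 24 powr (real CARD('n) * p) * 2 powr (1 + 2 * p)"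
  shows "ennpowr (absdiff (max_op R f x) (max_op R f y)) p
      / ennreal ((norm (x - y) + \<bar>R x - R y\<bar>) powr (\<epsilon> + s * p))
      / ennreal (norm (x - y) powr (real CARD('n) - \<epsilon>))
    \<le> ennreal K * (majorant p \<epsilon> s g G x y + majorant p \<epsilon> s g G y x)"
proof -
  let ?\<delta> = "norm (x - y) + \<bar>R x - R y\<bar>"
  define w where "w = ?\<delta> powr - (\<epsilon> + s * p) * norm (x - y) powr (\<epsilon> - real CARD('n))"
  have \<delta>: "0 < ?\<delta>" using xy by (intro add_pos_nonneg) auto
  have w: "0 < w" using xy \<delta> by (simp add: w_def)
  have w_eq: "ennreal (1 / ?\<delta> powr (\<epsilon> + s * p)) * ennreal (1 / norm (x - y) powr (real CARD('n) - \<epsilon>)) = ennreal w"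
  proof -
    have "1 / norm (x - y) powr (real CARD('n) - \<epsilon>) = norm (x - y) powr (\<epsilon> - real CARD('n))"
      using powr_minus_divide[of "norm (x - y)" "real CARD('n) - \<epsilon>"] by simp
    moreover have "1 / ?\<delta> powr (\<epsilon> + s * p) = ?\<delta> powr - (\<epsilon> + s * p)"
      by (simp only: powr_minus_divide)
    ultimately show ?thesis by (simp only: w_def ennreal_mult powr_ge_zero)
  qed
  have "ennpowr (absdiff (max_op R f x) (max_op R f y)) p / ennreal (?\<delta> powr (\<epsilon> + s * p))
      / ennreal (norm (x - y) powr (real CARD('n) - \<epsilon>))
    = ennpowr (absdiff (max_op R f x) (max_op R f y)) p * ennreal w"
    unfolding w_eq[symmetric] using \<delta> xy by (simp add: divide_ennreal_inverse mult.assoc)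
  also have "\<dots> \<le> ennreal K * majorant p \<epsilon> s g G x y + ennreal K * majorant p \<epsilon> s g G y x"
  proof (rule absdiff_ennpowr_le)
    show "max_op R f x \<le> max_op R f y + ennpowr (ennreal K * majorant p \<epsilon> s g G x y * ennreal (1 / w)) (1 / p)"
      using max_op_le_add[OF p \<epsilon> s x(1,2) y(1,2) xy] by (simp add: w_def K_def)
    show "max_op R f y \<le> max_op R f x + ennpowr (ennreal K * majorant p \<epsilon> s g G y x * ennreal (1 / w)) (1 / p)"
      using max_op_le_add[OF p \<epsilon> s y(1,2) x(1,2) xy[symmetric]]
      by (simp add: w_def K_def norm_minus_commute abs_minus_commute)
  qed (use p w x y in auto)
  finally show ?thesis by (simp add: distrib_left)
qed

text \<open>The integrability of \<open>|f|^p\<close> is used here: by the maximal theorem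
  \<open>hlmax\<close> of the restriction of \<open>g\<close> to \<open>G\<close> has finite p-th
  power integral, hence is finite almost everywhere, and it dominates \<open>max_op\<close> where
  \<open>f\<close> and \<open>g\<close> agree.\<close>

lemma max_op_finite:
  assumes p: "1 < p" and "in_Lp p G f"
  shows "AE x in lborel. x \<in> G \<longrightarrow> max_op R f x \<noteq> top"
proof -
  let ?h = "\<lambda>u. ennreal \<bar>g u\<bar> * indicator G u"
  obtain H :: real where H: "0 < H"
    "\<And>g :: real ^ 'n \<Rightarrow> ennreal. g \<in> borel_measurable borel \<Longrightarrow>
      (\<integral>\<^sup>+x. ennpowr (hlmax g x) p \<partial>lborel) \<le> ennreal H * (\<integral>\<^sup>+x. ennpowr (g x) p \<partial>lborel)"
    by (rule hlmax_strong[OF p]) blast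
  have "(\<integral>\<^sup>+x. ennpowr (?h x) p \<partial>lborel) = (\<integral>\<^sup>+x. ennreal (\<bar>f x\<bar> powr p) * indicator G x \<partial>lborel)"
    using ae by (intro nn_integral_cong_AE) (auto elim!: eventually_mono simp: indicator_def ennpowr_ennreal)
  also have "\<dots> = (\<integral>\<^sup>+x. ennreal (\<bar>f x\<bar> powr p) \<partial>lebesgue_on G)"
    by (rule nn_integral_lebesgue_on[symmetric]) simp
  also have "\<dots> < top"
    using assms(2) by (auto simp: in_Lp_def integrable_iff_bounded)
  finally have "ennreal H * (\<integral>\<^sup>+x. ennpowr (?h x) p \<partial>lborel) < top"
    by (simp add: ennreal_mult_less_top)
  then have "(\<integral>\<^sup>+x. ennpowr (hlmax ?h x) p \<partial>lborel) \<noteq> \<infinity>"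
    using H(2)[of ?h] by (auto simp: top_unique)
  then have "AE x in lborel. ennpowr (hlmax ?h x) p \<noteq> \<infinity>"
    by (intro nn_integral_noteq_infinite) auto
  then show ?thesis
    using ae
  proof eventually_elim
    case (elim x)
    then have "hlmax ?h x \<noteq> top" by auto
    then have "ennreal (2 ^ CARD('n)) * hlmax ?h x < top"
      by (simp add: ennreal_mult_less_top less_top)
    then show ?case using elim max_op_le_hlmax[of x] by (auto simp: top_unique)
  qed
qed

end

theorem theorem1p1:
  fixes p \<epsilon> :: real
  assumes "1 < p" and "0 < \<epsilon>" and "\<epsilon> < 1"
  shows "\<exists>C::real. C > 0 \<and>
    (\<forall>(G :: (real ^ 'n) set) (s :: real) (R :: real ^ 'n \<Rightarrow> real).
      open G \<longrightarrow> G \<noteq> {} \<longrightarrow> 0 < s \<longrightarrow> s < 1 \<longrightarrow>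
      R \<in> borel_measurable (lebesgue_on G) \<longrightarrow>
      (\<forall>x\<in>G. 0 \<le> R x \<and> ereal (R x) \<le> boundary_dist G x) \<longrightarrow>
      (\<forall>f :: real ^ 'n \<Rightarrow> real. in_Lp p G f \<longrightarrow>
        (\<integral>\<^sup>+ x. (\<integral>\<^sup>+ y.
            ennpowr (absdiff (max_op R f x) (max_op R f y)) p
              / ennreal ((norm (x - y) + \<bar>R x - R y\<bar>) powr (\<epsilon> + s * p))
              / ennreal (norm (x - y) powr (real CARD('n) - \<epsilon>))
          \<partial>lebesgue_on G) \<partial>lebesgue_on G)
        \<le> ennreal C *
          (\<integral>\<^sup>+ x. (\<integral>\<^sup>+ y.
            ennreal (\<bar>f x - f y\<bar> powr p)
              / ennreal (norm (x - y) powr (real CARD('n) + s * p))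
          \<partial>lebesgue_on G) \<partial>lebesgue_on G)))"
proof -
  note p = assms(1) and \<epsilon> = assms(2,3)
  define K where "K = 5 powr (real CARD('n) + p) * 24 powr (real CARD('n) * p) * 2 powr (1 + 2 * p)"
  have K: "0 < K" by (simp add: K_def)
  obtain D :: real where D: "0 < D"
    "\<And>s (f :: real ^ 'n \<Rightarrow> real) G. 0 < s \<Longrightarrow> s < 1 \<Longrightarrow> f \<in> borel_measurable borel \<Longrightarrow> G \<in> sets borel \<Longrightarrow>
      (\<integral>\<^sup>+x. (\<integral>\<^sup>+y. majorant p \<epsilon> s f G x y \<partial>lborel) \<partial>lborel)
       \<le> ennreal D * (\<integral>\<^sup>+x. (\<integral>\<^sup>+y. ennpowr (wosc (real DIM(real ^ 'n) / p + s) f G x y) p \<partial>lborel) \<partial>lborel)"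
    by (rule majorant_integral[OF p \<epsilon>]) blast
  show ?thesis
  proof (intro exI[of _ "K * (2 * D)"] conjI allI impI)
    show "0 < K * (2 * D)" using K D by simp
    fix G :: "(real ^ 'n) set" and s :: real and R f :: "real ^ 'n \<Rightarrow> real"
    assume G: "open G" and s: "0 < s" "s < 1"
      and R: "\<forall>x\<in>G. 0 \<le> R x \<and> ereal (R x) \<le> boundary_dist G x" and f: "in_Lp p G f"
    have Gb [measurable]: "G \<in> sets borel" using G by simp
    \<comment> \<open>Extension by zero gives a Lebesgue measurable function on the whole space,
      which coincides almost everywhere with a Borel function.\<close>
    have "(\<lambda>x. if x \<in> G then f x else 0) \<in> borel_measurable lebesgue"
      using f G by (subst borel_measurable_if) (auto simp: in_Lp_def)
    from completion_ex_borel_measurable_real[OF this]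
    obtain g where g: "g \<in> borel_measurable lborel" and fg: "AE x in lborel. (if x \<in> G then f x else 0) = g x"
      by blast
    have g [measurable]: "g \<in> borel_measurable borel" using g by simp
    have ae: "AE x in lborel. x \<in> G \<longrightarrow> f x = g x"
      using fg by eventually_elim auto
    interpret radius_function G R f g
      by unfold_locales (use G R g ae in auto)
    let ?E = "\<lambda>x y. ennpowr (absdiff (max_op R f x) (max_op R f y)) p
              / ennreal ((norm (x - y) + \<bar>R x - R y\<bar>) powr (\<epsilon> + s * p))
              / ennreal (norm (x - y) powr (real CARD('n) - \<epsilon>))"
    let ?F = "\<lambda>x y. ennreal (\<bar>f x - f y\<bar> powr p) / ennreal (norm (x - y) powr (real CARD('n) + s * p))"
    let ?M = "majorant p \<epsilon> s g G" and ?W = "\<lambda>x y. ennpowr (wosc (real DIM(real ^ 'n) / p + s) g G x y) p"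
    note fin = max_op_finite[OF p f]
    have "(\<integral>\<^sup>+x. (\<integral>\<^sup>+y. ?E x y \<partial>lebesgue_on G) \<partial>lebesgue_on G)
        = (\<integral>\<^sup>+x. (\<integral>\<^sup>+y. ?E x y * indicator G y \<partial>lborel) * indicator G x \<partial>lborel)"
      using Gb by (simp only: nn_integral_lebesgue_on)
    also have "\<dots> \<le> (\<integral>\<^sup>+x. (\<integral>\<^sup>+y. ennreal K * (?M x y + ?M y x) \<partial>lborel) \<partial>lborel)"
      using fin ae
    proof (intro nn_integral_mono_AE, eventually_elim)
      fix x assume x: "x \<in> G \<longrightarrow> max_op R f x \<noteq> top" "x \<in> G \<longrightarrow> f x = g x"
      show "(\<integral>\<^sup>+y. ?E x y * indicator G y \<partial>lborel) * indicator G x \<le> (\<integral>\<^sup>+y. ennreal K * (?M x y + ?M y x) \<partial>lborel)"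
      proof (cases "x \<in> G")
        case True
        have "(\<integral>\<^sup>+y. ?E x y * indicator G y \<partial>lborel) \<le> (\<integral>\<^sup>+y. ennreal K * (?M x y + ?M y x) \<partial>lborel)"
          \<comment> \<open>The pointwise bound requires \<open>x \<noteq> y\<close>; for fixed
            \<open>x\<close> the excluded point has measure zero.\<close>
          using fin ae AE_lborel_singleton[of x]
        proof (intro nn_integral_mono_AE, eventually_elim)
          fix y assume y: "y \<in> G \<longrightarrow> max_op R f y \<noteq> top" "y \<in> G \<longrightarrow> f y = g y" "y \<noteq> x"
          show "?E x y * indicator G y \<le> ennreal K * (?M x y + ?M y x)"
            using energy_le_majorant[OF p \<epsilon> s, of x y] x y True
            by (cases "y \<in> G") (simp_all add: K_def)
        qed
        then show ?thesis using True by simp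
      qed simp
    qed
    also have "\<dots> = ennreal K * (\<integral>\<^sup>+x. (\<integral>\<^sup>+y. ?M x y + ?M y x \<partial>lborel) \<partial>lborel)"
      by (rule nn_integral_cmult2) measurable
    also have "(\<integral>\<^sup>+x. (\<integral>\<^sup>+y. ?M x y + ?M y x \<partial>lborel) \<partial>lborel)
        = (\<integral>\<^sup>+x. (\<integral>\<^sup>+y. ?M x y \<partial>lborel) \<partial>lborel) + (\<integral>\<^sup>+x. (\<integral>\<^sup>+y. ?M y x \<partial>lborel) \<partial>lborel)"
      by (rule nn_integral_add2) measurable
    \<comment> \<open>The reflected majorant has the same double integral, which explains the factor
      \<open>2\<close> in the constant.\<close>
    also have "(\<integral>\<^sup>+x. (\<integral>\<^sup>+y. ?M y x \<partial>lborel) \<partial>lborel) = (\<integral>\<^sup>+x. (\<integral>\<^sup>+y. ?M x y \<partial>lborel) \<partial>lborel)"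
      by (rule lborel_pair.Fubini') measurable
    also have "ennreal K * ((\<integral>\<^sup>+x. (\<integral>\<^sup>+y. ?M x y \<partial>lborel) \<partial>lborel) + (\<integral>\<^sup>+x. (\<integral>\<^sup>+y. ?M x y \<partial>lborel) \<partial>lborel))
        \<le> ennreal K * (2 * (ennreal D * (\<integral>\<^sup>+x. (\<integral>\<^sup>+y. ?W x y \<partial>lborel) \<partial>lborel)))"
      unfolding mult_2[symmetric] using s by (intro mult_left_mono D) auto
    also have "\<dots> = ennreal (K * (2 * D)) * (\<integral>\<^sup>+x. (\<integral>\<^sup>+y. ?W x y \<partial>lborel) \<partial>lborel)"
      using K D by (simp add: ennreal_mult mult.assoc)
    \<comment> \<open>Off the diagonal and inside \<open>G\<close> the two integrands coincide
      wherever \<open>f\<close> and \<open>g\<close> agree; outside \<open>G\<close> the cutoffs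
      make both vanish.\<close>
    also have "(\<integral>\<^sup>+x. (\<integral>\<^sup>+y. ?W x y \<partial>lborel) \<partial>lborel)
        = (\<integral>\<^sup>+x. (\<integral>\<^sup>+y. ?F x y * indicator G y \<partial>lborel) * indicator G x \<partial>lborel)"
      using ae
    proof (intro nn_integral_cong_AE, eventually_elim)
      fix x assume x: "x \<in> G \<longrightarrow> f x = g x"
      show "(\<integral>\<^sup>+y. ?W x y \<partial>lborel) = (\<integral>\<^sup>+y. ?F x y * indicator G y \<partial>lborel) * indicator G x"
      proof (cases "x \<in> G")
        case True
        have "(\<integral>\<^sup>+y. ?W x y \<partial>lborel) = (\<integral>\<^sup>+y. ?F x y * indicator G y \<partial>lborel)"
          using ae AE_lborel_singleton[of x]
        proof (intro nn_integral_cong_AE, eventually_elim)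
          fix y assume y: "y \<in> G \<longrightarrow> f y = g y" "y \<noteq> x"
          then have "1 / norm (x - y) powr (real CARD('n) + s * p) = norm (x - y) powr - (real CARD('n) + s * p)"
            by (simp only: powr_minus_divide)
          then have F: "?F x y = ennreal (\<bar>f x - f y\<bar> powr p) * ennreal (norm (x - y) powr - (real CARD('n) + s * p))"
            using y by (simp add: divide_ennreal_inverse)
          show "?W x y = ?F x y * indicator G y"
            unfolding F using x y True p
            by (subst ennpowr_wosc) (auto simp: osc_def ennpowr_ennreal indicator_def)
        qed
        then show ?thesis using True by simp
      next
        case False
        then show ?thesis using p by (simp add: wosc_def osc_def)
      qed
    qed
    also have "\<dots> = (\<integral>\<^sup>+x. (\<integral>\<^sup>+y. ?F x y \<partial>lebesgue_on G) \<partial>lebesgue_on G)"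
      using Gb by (simp only: nn_integral_lebesgue_on)
    finally show "(\<integral>\<^sup>+x. (\<integral>\<^sup>+y. ?E x y \<partial>lebesgue_on G) \<partial>lebesgue_on G)
        \<le> ennreal (K * (2 * D)) * (\<integral>\<^sup>+x. (\<integral>\<^sup>+y. ?F x y \<partial>lebesgue_on G) \<partial>lebesgue_on G)" .
  qed
qed

end
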